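(* Let $G$ be a group which acts coboundedly and acylindrically on a hyperbolic space $S$. Then for any abstract group homomorphism $\varphi:\mathrm{HEG}\rightarrow G$ there exists a natural number $n$ such that $\varphi(\mathrm{HEG}^n)$ is a subgroup of $G$ consisting only of elements that are elliptic with respect to this action.
   Context: The Hawaiian earring group $\mathrm{HEG}$ is the fundamental group, at the basepoint $(0,0)$, of $\bigcup_{n\geqslant 1}C_n\subset\mathbb{R}^2$, where $C_n$ is the circle with center $(-\frac1n,0)$ and radius $\frac1n$. Combinatorially: let $A=\{a_n^{\pm1}\}_{n\in\mathbb{N}}$ be a countably infinite set of letters with formal inverses, $\mathbb N=\{1,2,\dots\}$. A word is a map $w:X\to A$ with $X$ a totally ordered set such that $\{i\in X\mid w(i)=a\}$ is finite for each $a\in A$; words are identified if they differ by an order isomorphism of domains. Concatenation of words and the inverse word $w^{-1}$ (reverse the order and invert letters) are defined in the obvious way. For $n\geqslant 0$ let $p_n(w)$ be the restriction of $w$ to $\{i\mid w(i)\in\{a_1^{\pm1},\dots,a_n^{\pm1}\}\}$, a finite word, regarded as an element of the free group $F_n$ on $a_1,\dots,a_n$. Put $w\sim u$ if $p_n(w)=p_n(u)$ in $F_n$ for all $n$. Then $\mathrm{HEG}$ is the set of $\sim$-classes with multiplication $[w][u]=[wu]$. The subgroup $\mathrm{HEG}^n$ consists of the elements having a representative $w:X\to A$ with $w(X)\cap\{a_1^{\pm1},\dots,a_n^{\pm1}\}=\emptyset$. All group actions on metric spaces are by isometries. A hyperbolic space is a geodesic metric space which is Gromov hyperbolic ($\delta$-thin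 geodesic triangles for some $\delta\geqslant 0$). An action of $G$ on $S$ is cobounded if $S=G\cdot B$ for some bounded $B\subset S$. It is acylindrical if for each $\epsilon>0$ there exist $R,N>0$ such that for all $p,q\in S$ with $d(p,q)\geqslant R$ the set $\{g\in G\mid d(p,gp)\leqslant\epsilon \text{ and } d(q,gq)\leqslant\epsilon\}$ has at most $N$ elements. An element $g\in G$ is elliptic if some (equivalently, every) orbit of $\langle g\rangle$ in $S$ is bounded. *)

theory Defs
  imports
    "HOL-Algebra.Group_Action"
    "HOL-Algebra.Generated_Groups"
    "HOL-Analysis.Elementary_Metric_Spaces"
begin

section \<open>Finite words and equality in the free group of rank n\<close>

text \<open>The pair \<open>(k, True)\<close> with \<open>k \<ge> 1\<close> stands for the letter \<open>a\<^sub>k\<close>,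
  and \<open>(k, False)\<close> for its formal inverse.\<close>

type_synonym letter = "nat \<times> bool"

definition inv_letter :: "letter \<Rightarrow> letter" where
  "inv_letter a = (fst a, \<not> snd a)"

definition letters :: "letter set" where
  "letters = {1..} \<times> UNIV"

definition letters_upto :: "nat \<Rightarrow> letter set" where
  "letters_upto n = {1..n} \<times> UNIV"

definition cancellation :: "nat \<Rightarrow> letter list rel" where
  "cancellation n = {(xs @ [a, inv_letter a] @ ys, xs @ ys) | xs a ys.
     a \<in> letters_upto n \<and> set xs \<subseteq> letters_upto n \<and> set ys \<subseteq> letters_upto n}"

text \<open>The free group on \<open>a\<^sub>1, \<dots>, a\<^sub>n\<close> is the set of finite words over
  \<open>letters_upto n\<close> modulo this equivalence.\<close>

definition free_eq :: "nat \<Rightarrow> letter list rel" where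
  "free_eq n = (cancellation n \<union> (cancellation n)\<inverse>)\<^sup>*"


section \<open>Infinite words\<close>

record 'x iword =
  wdom :: "'x set"
  wle  :: "'x rel"
  wlab :: "'x \<Rightarrow> letter"

text \<open>The values of \<open>wlab w\<close> outside \<open>wdom w\<close> are irrelevant.\<close>

definition is_word :: "'x iword \<Rightarrow> bool" where
  "is_word w \<longleftrightarrow> linear_order_on (wdom w) (wle w) \<and> wlab w ` wdom w \<subseteq> letters \<and>
     (\<forall>a. finite {i \<in> wdom w. wlab w i = a})"

definition positions :: "nat \<Rightarrow> 'x iword \<Rightarrow> 'x set" where
  "positions n w = {i \<in> wdom w. wlab w i \<in> letters_upto n}"

definition proj_word :: "nat \<Rightarrow> 'x iword \<Rightarrow> letter list" where
  "proj_word n w = map (wlab w) (THE xs. distinct xs \<and> set xs = positions n w \<and>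
     sorted_wrt (\<lambda>i j. (i, j) \<in> wle w) xs)"

definition word_equiv :: "'x iword \<Rightarrow> 'y iword \<Rightarrow> bool" where
  "word_equiv w u \<longleftrightarrow> (\<forall>n. (proj_word n w, proj_word n u) \<in> free_eq n)"

definition word_append :: "'x iword \<Rightarrow> 'y iword \<Rightarrow> ('x + 'y) iword" where
  "word_append w u =
     \<lparr> wdom = wdom w <+> wdom u,
       wle = {(Inl i, Inl j) | i j. (i, j) \<in> wle w} \<union> {(Inr i, Inr j) | i j. (i, j) \<in> wle u} \<union>
             {(Inl i, Inr j) | i j. i \<in> wdom w \<and> j \<in> wdom u},
       wlab = case_sum (wlab w) (wlab u) \<rparr>"

definition word_inverse :: "'x iword \<Rightarrow> 'x iword" where
  "word_inverse w = \<lparr> wdom = wdom w, wle = (wle w)\<inverse>, wlab = inv_letter \<circ> wlab w \<rparr>"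

definition word_iso :: "'x iword \<Rightarrow> 'y iword \<Rightarrow> bool" where
  "word_iso w u \<longleftrightarrow> (\<exists>f. bij_betw f (wdom w) (wdom u) \<and>
     (\<forall>i\<in>wdom w. \<forall>j\<in>wdom w. (i, j) \<in> wle w \<longleftrightarrow> (f i, f j) \<in> wle u) \<and>
     (\<forall>i\<in>wdom w. wlab w i = wlab u (f i)))"


section \<open>The Hawaiian earring group\<close>

text \<open>The domain of a word is countable, so every word is isomorphic to one whose domain is a
  set of natural numbers (lemma \<open>ex_nat_word_iso\<close> below), and isomorphic words are equivalent
  (lemma \<open>word_iso_imp_equiv\<close>).  Hence the elements of the group are taken to be the
  equivalence classes of words over \<^typ>\<open>nat\<close>.  A word over any other type also determines
  such a class, which is how products are formed.\<close>

definition word_class :: "'x iword \<Rightarrow> nat iword set" where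
  "word_class w = {v. is_word v \<and> word_equiv v w}"

definition HEG :: "nat iword set monoid" where
  "HEG = \<lparr> carrier = {word_class w | w :: nat iword. is_word w},
           mult = (\<lambda>P Q. \<Union>w\<in>P. \<Union>u\<in>Q. word_class (word_append w u)),
           one = word_class (\<lparr> wdom = {}, wle = {}, wlab = (\<lambda>_. (1, True)) \<rparr> :: nat iword) \<rparr>"

definition HEG_tail :: "nat \<Rightarrow> nat iword set set" where
  "HEG_tail n = {P \<in> carrier HEG. \<exists>w\<in>P. wlab w ` wdom w \<inter> letters_upto n = {}}"


section \<open>Hyperbolic spaces and actions\<close>

text \<open>A geodesic segment is represented by its arc-length parametrisation on \<open>[0, d(x, y)]\<close>.\<close>

definition geodesic_from_to :: "(real \<Rightarrow> 's::metric_space) \<Rightarrow> 's \<Rightarrow> 's \<Rightarrow> bool" where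
  "geodesic_from_to c x y \<longleftrightarrow> c 0 = x \<and> c (dist x y) = y \<and>
     (\<forall>s\<in>{0..dist x y}. \<forall>t\<in>{0..dist x y}. dist (c s) (c t) = \<bar>s - t\<bar>)"

definition geodesic_segment :: "'s::metric_space set \<Rightarrow> 's \<Rightarrow> 's \<Rightarrow> bool" where
  "geodesic_segment A x y \<longleftrightarrow> (\<exists>c. geodesic_from_to c x y \<and> A = c ` {0..dist x y})"

definition geodesic_space :: "'s::metric_space itself \<Rightarrow> bool" where
  "geodesic_space _ \<longleftrightarrow> (\<forall>x y :: 's. \<exists>A. geodesic_segment A x y)"

definition thin_triangles :: "real \<Rightarrow> 's::metric_space itself \<Rightarrow> bool" where
  "thin_triangles \<delta> _ \<longleftrightarrow> (\<forall>(x::'s) y z A B C.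
     geodesic_segment A x y \<longrightarrow> geodesic_segment B y z \<longrightarrow> geodesic_segment C x z \<longrightarrow>
     (\<forall>p\<in>A. \<exists>q\<in>B \<union> C. dist p q \<le> \<delta>) \<and>
     (\<forall>p\<in>B. \<exists>q\<in>A \<union> C. dist p q \<le> \<delta>) \<and>
     (\<forall>p\<in>C. \<exists>q\<in>A \<union> B. dist p q \<le> \<delta>))"

definition hyperbolic_space :: "'s::metric_space itself \<Rightarrow> bool" where
  "hyperbolic_space S \<longleftrightarrow> geodesic_space S \<and> (\<exists>\<delta>\<ge>0. thin_triangles \<delta> S)"

definition isometric_action ::
    "('g, 'm) monoid_scheme \<Rightarrow> ('g \<Rightarrow> 's::metric_space \<Rightarrow> 's) \<Rightarrow> bool" where
  "isometric_action G act \<longleftrightarrow> group_action G UNIV act \<and>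
     (\<forall>g\<in>carrier G. \<forall>x y. dist (act g x) (act g y) = dist x y)"

definition cobounded_action ::
    "('g, 'm) monoid_scheme \<Rightarrow> ('g \<Rightarrow> 's::metric_space \<Rightarrow> 's) \<Rightarrow> bool" where
  "cobounded_action G act \<longleftrightarrow> (\<exists>B. bounded B \<and> (\<Union>g\<in>carrier G. act g ` B) = UNIV)"

definition acylindrical_action ::
    "('g, 'm) monoid_scheme \<Rightarrow> ('g \<Rightarrow> 's::metric_space \<Rightarrow> 's) \<Rightarrow> bool" where
  "acylindrical_action G act \<longleftrightarrow> (\<forall>\<epsilon>>0. \<exists>R>0. \<exists>N::nat. N > 0 \<and> (\<forall>p q. dist p q \<ge> R \<longrightarrow>
     finite {g \<in> carrier G. dist p (act g p) \<le> \<epsilon> \<and> dist q (act g q) \<le> \<epsilon>} \<and>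
     card {g \<in> carrier G. dist p (act g p) \<le> \<epsilon> \<and> dist q (act g q) \<le> \<epsilon>} \<le> N))"

definition elliptic ::
    "('g, 'm) monoid_scheme \<Rightarrow> ('g \<Rightarrow> 's::metric_space \<Rightarrow> 's) \<Rightarrow> 'g \<Rightarrow> bool" where
  "elliptic G act g \<longleftrightarrow> (\<exists>x. bounded (orbit (G\<lparr>carrier := generate G {g}\<rparr>) act x))"


section \<open>The Hawaiian earring group is a group\<close>

subsection \<open>Equality in free groups\<close>

lemma letters_upto_subset: "letters_upto n \<subseteq> letters"
  by (auto simp: letters_upto_def letters_def)

lemma inv_letter_in_upto [simp]: "inv_letter a \<in> letters_upto n \<longleftrightarrow> a \<in> letters_upto n"
  by (cases a) (auto simp: inv_letter_def letters_upto_def)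

lemma inv_letter_inv_letter [simp]: "inv_letter (inv_letter a) = a"
  by (simp add: inv_letter_def)

lemma free_eq_refl [simp]: "(xs, xs) \<in> free_eq n"
  by (simp add: free_eq_def)

lemma free_eq_sym: "(xs, ys) \<in> free_eq n \<Longrightarrow> (ys, xs) \<in> free_eq n"
  unfolding free_eq_def by (metis converse_Un converse_converse rtrancl_converseD sup_commute)

lemma free_eq_trans: "(xs, ys) \<in> free_eq n \<Longrightarrow> (ys, zs) \<in> free_eq n \<Longrightarrow> (xs, zs) \<in> free_eq n"
  unfolding free_eq_def by (rule rtrancl_trans)

lemma cancellation_context:
  assumes "(u, v) \<in> cancellation n" "set xs \<subseteq> letters_upto n" "set ys \<subseteq> letters_upto n"
  shows "(xs @ u @ ys, xs @ v @ ys) \<in> cancellation n"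
proof -
  obtain p a q where "u = p @ [a, inv_letter a] @ q" "v = p @ q" "a \<in> letters_upto n"
      "set p \<subseteq> letters_upto n" "set q \<subseteq> letters_upto n"
    using assms(1) unfolding cancellation_def by blast
  then have "xs @ u @ ys = (xs @ p) @ [a, inv_letter a] @ (q @ ys)" "xs @ v @ ys = (xs @ p) @ (q @ ys)"
    "set (xs @ p) \<subseteq> letters_upto n" "set (q @ ys) \<subseteq> letters_upto n"
    using assms(2,3) by auto
  then show ?thesis
    unfolding cancellation_def using \<open>a \<in> letters_upto n\<close> by blast
qed

lemma free_eq_context:
  assumes "(u, v) \<in> free_eq n" "set xs \<subseteq> letters_upto n" "set ys \<subseteq> letters_upto n"
  shows "(xs @ u @ ys, xs @ v @ ys) \<in> free_eq n"
  using assms(1) unfolding free_eq_def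
proof (induction rule: rtrancl_induct)
  case (step v w)
  then have "(xs @ v @ ys, xs @ w @ ys) \<in> cancellation n \<union> (cancellation n)\<inverse>"
    using assms(2,3) by (auto intro: cancellation_context)
  with step.IH show ?case by (rule rtrancl_into_rtrancl)
qed simp

lemma free_eq_append:
  assumes "(u, u') \<in> free_eq n" "(v, v') \<in> free_eq n"
    and "set u' \<subseteq> letters_upto n" "set v \<subseteq> letters_upto n"
  shows "(u @ v, u' @ v') \<in> free_eq n"
  using free_eq_context[OF assms(1), of "[]" v] free_eq_context[OF assms(2), of u' "[]"] assms(3,4)
  by (auto intro: free_eq_trans)

lemma free_eq_inverse:
  "set xs \<subseteq> letters_upto n \<Longrightarrow> (rev (map inv_letter xs) @ xs, []) \<in> free_eq n"
proof (induction xs)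
  case (Cons a xs)
  have "inv_letter a \<in> letters_upto n" "set (rev (map inv_letter xs)) \<subseteq> letters_upto n"
    "set xs \<subseteq> letters_upto n"
    using Cons.prems by (auto simp del: split_paired_All)
  then have "(rev (map inv_letter xs) @ [inv_letter a, inv_letter (inv_letter a)] @ xs,
         rev (map inv_letter xs) @ xs) \<in> cancellation n"
    unfolding cancellation_def by blast
  then have "(rev (map inv_letter (a # xs)) @ a # xs, rev (map inv_letter xs) @ xs) \<in> free_eq n"
    unfolding free_eq_def by (intro r_into_rtrancl) simp
  with Cons show ?case by (auto intro: free_eq_trans)
qed simp


subsection \<open>Projections of words\<close>

lemma sorted_wrt_unique:
  assumes "antisym r" "sorted_wrt (\<lambda>i j. (i, j) \<in> r) xs" "sorted_wrt (\<lambda>i j. (i, j) \<in> r) ys"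
    and "distinct xs" "distinct ys" "set xs = set ys"
  shows "xs = ys"
  using assms(2-)
proof (induction xs arbitrary: ys)
  case (Cons x xs)
  then obtain y zs where ys: "ys = y # zs" by (cases ys) auto
  have "x = y"
    using Cons.prems ys assms(1) unfolding antisym_def
    by (metis list.set_intros(1) set_ConsD sorted_wrt.simps(2))
  moreover have "set xs = set zs"
    using Cons.prems ys \<open>x = y\<close> by auto
  ultimately show ?case
    using Cons ys by auto
qed simp

lemma ex_sorted_wrt:
  assumes "linear_order_on X r" "finite A" "A \<subseteq> X"
  shows "\<exists>xs. distinct xs \<and> set xs = A \<and> sorted_wrt (\<lambda>i j. (i, j) \<in> r) xs"
  using assms(2,3)
proof (induction A rule: finite_induct)
  case (insert a A)
  then obtain xs where xs: "distinct xs" "set xs = A" "sorted_wrt (\<lambda>i j. (i, j) \<in> r) xs" by auto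
  let ?ys = "filter (\<lambda>x. (x, a) \<in> r) xs @ [a] @ filter (\<lambda>x. (x, a) \<notin> r) xs"
  have tr: "trans r" and tot: "total_on X r"
    using assms(1) by (auto simp: order_on_defs)
  have ge: "(a, x) \<in> r" if "x \<in> A" "(x, a) \<notin> r" for x
    using tot that insert by (auto simp: total_on_def)
  have "distinct ?ys" "set ?ys = insert a A" using xs insert by auto
  moreover have "sorted_wrt (\<lambda>i j. (i, j) \<in> r) ?ys"
    using xs ge tr by (auto simp: sorted_wrt_append sorted_wrt_filter dest: transD)
  ultimately show ?case by blast
qed simp

lemma finite_positions:
  assumes "is_word w" shows "finite (positions n w)"
proof -
  have "positions n w = (\<Union>a\<in>letters_upto n. {i \<in> wdom w. wlab w i = a})"
    by (auto simp: positions_def)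
  moreover have "finite (letters_upto n)" by (simp add: letters_upto_def)
  ultimately show ?thesis using assms by (simp add: is_word_def del: split_paired_All)
qed

lemma proj_word_eq:
  assumes "is_word w" "distinct xs" "set xs = positions n w"
    "sorted_wrt (\<lambda>i j. (i, j) \<in> wle w) xs"
  shows "proj_word n w = map (wlab w) xs"
proof -
  have "antisym (wle w)" using assms(1) by (auto simp: is_word_def order_on_defs)
  then have "(THE xs. distinct xs \<and> set xs = positions n w \<and>
      sorted_wrt (\<lambda>i j. (i, j) \<in> wle w) xs) = xs"
    using assms(2-) by (intro the_equality) (auto intro: sorted_wrt_unique)
  then show ?thesis by (simp add: proj_word_def)
qed

lemma proj_wordE:
  assumes "is_word w"
  obtains xs where "distinct xs" "set xs = positions n w" "sorted_wrt (\<lambda>i j. (i, j) \<in> wle w) xs"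
    "proj_word n w = map (wlab w) xs"
proof -
  have "linear_order_on (wdom w) (wle w)" using assms by (simp add: is_word_def)
  from ex_sorted_wrt[OF this finite_positions[OF assms]] show ?thesis
    using that proj_word_eq[OF assms] by (fastforce simp: positions_def)
qed

lemma set_proj_word: "is_word w \<Longrightarrow> set (proj_word n w) \<subseteq> letters_upto n"
  by (erule proj_wordE[where n = n]) (auto simp: positions_def)

lemma is_word_append:
  assumes "is_word w" "is_word u"
  shows "is_word (word_append w u)"
proof -
  have "linear_order_on (wdom w <+> wdom u) (wle (word_append w u))"
    unfolding order_on_defs
  proof (intro conjI)
    have lin: "linear_order_on (wdom w) (wle w)" "linear_order_on (wdom u) (wle u)"
      using assms by (auto simp: is_word_def)
    show "wle (word_append w u) \<subseteq> (wdom w <+> wdom u) \<times> (wdom w <+> wdom u)"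
      using lin by (auto simp: word_append_def order_on_defs)
    show "refl_on (wdom w <+> wdom u) (wle (word_append w u))"
      using lin by (auto simp: word_append_def order_on_defs refl_on_def)
    show "trans (wle (word_append w u))"
      using lin by (auto simp: word_append_def order_on_defs intro!: transI dest: transD)
    show "antisym (wle (word_append w u))"
      using lin by (auto simp: word_append_def order_on_defs intro!: antisymI dest: antisymD)
    have tot: "\<And>i j. i \<in> wdom w \<Longrightarrow> j \<in> wdom w \<Longrightarrow> i \<noteq> j \<Longrightarrow> (i, j) \<notin> wle w \<Longrightarrow> (j, i) \<in> wle w"
      "\<And>i j. i \<in> wdom u \<Longrightarrow> j \<in> wdom u \<Longrightarrow> i \<noteq> j \<Longrightarrow> (i, j) \<notin> wle u \<Longrightarrow> (j, i) \<in> wle u"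
      using lin by (auto simp: order_on_defs total_on_def)
    show "total_on (wdom w <+> wdom u) (wle (word_append w u))"
      by (rule total_onI) (auto simp: word_append_def intro: tot)
  qed
  moreover have "finite {i \<in> wdom w <+> wdom u. case_sum (wlab w) (wlab u) i = a}" for a
  proof -
    have "{i \<in> wdom w <+> wdom u. case_sum (wlab w) (wlab u) i = a} =
        {i \<in> wdom w. wlab w i = a} <+> {i \<in> wdom u. wlab u i = a}" by auto
    then show ?thesis using assms by (simp add: is_word_def del: split_paired_All)
  qed
  ultimately show ?thesis
    using assms by (auto simp: is_word_def word_append_def)
qed

lemma proj_word_append:
  assumes "is_word w" "is_word u"
  shows "proj_word n (word_append w u) = proj_word n w @ proj_word n u"
proof -
  obtain xs where xs: "distinct xs" "set xs = positions n w" "sorted_wrt (\<lambda>i j. (i, j) \<in> wle w) xs"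
    "proj_word n w = map (wlab w) xs" using assms(1) by (rule proj_wordE)
  obtain ys where ys: "distinct ys" "set ys = positions n u" "sorted_wrt (\<lambda>i j. (i, j) \<in> wle u) ys"
    "proj_word n u = map (wlab u) ys" using assms(2) by (rule proj_wordE)
  have "proj_word n (word_append w u) =
      map (wlab (word_append w u)) (map Inl xs @ map Inr ys)"
  proof (rule proj_word_eq)
    show "is_word (word_append w u)" using assms by (rule is_word_append)
    show "distinct (map Inl xs @ map Inr ys)" using xs ys by (auto simp: distinct_map)
    show "set (map Inl xs @ map Inr ys) = positions n (word_append w u)"
      using xs(2) ys(2) by (auto simp: positions_def word_append_def)
    show "sorted_wrt (\<lambda>i j. (i, j) \<in> wle (word_append w u)) (map Inl xs @ map Inr ys)"
      using xs ys by (auto simp: sorted_wrt_append sorted_wrt_map word_append_def positions_def)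
  qed
  then show ?thesis using xs ys by (simp add: word_append_def)
qed

lemma is_word_inverse:
  assumes "is_word w" shows "is_word (word_inverse w)"
proof -
  have "{i \<in> wdom w. inv_letter (wlab w i) = a} = {i \<in> wdom w. wlab w i = inv_letter a}" for a
    by (auto simp: inv_letter_def)
  then show ?thesis
    using assms by (auto simp: is_word_def word_inverse_def inv_letter_def letters_def)
qed

lemma proj_word_inverse:
  assumes "is_word w"
  shows "proj_word n (word_inverse w) = rev (map inv_letter (proj_word n w))"
proof -
  obtain xs where xs: "distinct xs" "set xs = positions n w" "sorted_wrt (\<lambda>i j. (i, j) \<in> wle w) xs"
    "proj_word n w = map (wlab w) xs" using assms by (rule proj_wordE)
  have "proj_word n (word_inverse w) = map (wlab (word_inverse w)) (rev xs)"
    by (rule proj_word_eq)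
      (use xs is_word_inverse[OF assms] in
        \<open>auto simp: positions_def word_inverse_def sorted_wrt_rev\<close>)
  then show ?thesis using xs by (simp add: word_inverse_def rev_map)
qed

lemma word_iso_imp_equiv:
  assumes "is_word w" "is_word u" "word_iso w u"
  shows "word_equiv w u"
proof -
  obtain f where f: "bij_betw f (wdom w) (wdom u)"
    "\<And>i j. i \<in> wdom w \<Longrightarrow> j \<in> wdom w \<Longrightarrow> (i, j) \<in> wle w \<longleftrightarrow> (f i, f j) \<in> wle u"
    "\<And>i. i \<in> wdom w \<Longrightarrow> wlab w i = wlab u (f i)"
    using assms(3) unfolding word_iso_def by blast
  have "proj_word n w = proj_word n u" for n
  proof -
    obtain xs where xs: "distinct xs" "set xs = positions n w"
      "sorted_wrt (\<lambda>i j. (i, j) \<in> wle w) xs" "proj_word n w = map (wlab w) xs"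
      using assms(1) by (rule proj_wordE)
    have sub: "set xs \<subseteq> wdom w" using xs(2) by (auto simp: positions_def)
    have "proj_word n u = map (wlab u) (map f xs)"
    proof (rule proj_word_eq[OF assms(2)])
      show "distinct (map f xs)"
        using f(1) xs(1) sub by (auto simp: distinct_map bij_betw_def intro: inj_on_subset)
      show "set (map f xs) = positions n u"
      proof -
        have "f ` positions n w = positions n u"
          using f(1,3) unfolding positions_def bij_betw_def by force
        then show ?thesis using xs(2) by simp
      qed
      show "sorted_wrt (\<lambda>i j. (i, j) \<in> wle u) (map f xs)"
        unfolding sorted_wrt_map
        by (rule sorted_wrt_mono_rel[OF _ xs(3)]) (use f(2) sub in blast)
    qed
    then show ?thesis using xs(4) f(3) sub by auto
  qed
  then show ?thesis by (simp add: word_equiv_def)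
qed

lemma ex_nat_word_iso:
  fixes w :: "'x iword"
  assumes "is_word w"
  shows "\<exists>v :: nat iword. is_word v \<and> word_iso v w"
proof -
  have "wdom w = (\<Union>a::letter. {i \<in> wdom w. wlab w i = a})" by auto
  moreover have "countable (\<Union>a::letter. {i \<in> wdom w. wlab w i = a})"
    using assms by (intro countable_UN) (auto simp: is_word_def countable_finite)
  ultimately have "countable (wdom w)" by simp
  then obtain f :: "'x \<Rightarrow> nat" where f: "inj_on f (wdom w)" by (auto simp: countable_def)
  define g where "g = the_inv_into (wdom w) f"
  define v where "v = \<lparr> wdom = f ` wdom w,
    wle = {(i, j). i \<in> f ` wdom w \<and> j \<in> f ` wdom w \<and> (g i, g j) \<in> wle w}, wlab = wlab w \<circ> g \<rparr>"
  have g: "g (f i) = i" if "i \<in> wdom w" for i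
    unfolding g_def using f that by (rule the_inv_into_f_f)
  have lin: "linear_order_on (wdom w) (wle w)" using assms by (simp add: is_word_def)
  have "linear_order_on (wdom v) (wle v)"
    unfolding order_on_defs
  proof (intro conjI)
    show "refl_on (wdom v) (wle v)"
      using lin g by (auto simp: v_def order_on_defs refl_on_def)
    show "trans (wle v)"
      using lin g by (auto simp: v_def order_on_defs intro!: transI dest: transD)
    show "antisym (wle v)"
      using lin g by (auto simp: v_def order_on_defs intro!: antisymI dest: antisymD)
    show "total_on (wdom v) (wle v)"
      using lin g by (auto simp: v_def order_on_defs total_on_def)
  qed (auto simp: v_def)
  moreover have "{i \<in> wdom v. wlab v i = a} = f ` {i \<in> wdom w. wlab w i = a}" for a
    by (auto simp: v_def g)
  ultimately have "is_word v"
    using assms by (auto simp: is_word_def v_def g)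
  moreover have "word_iso v w"
    unfolding word_iso_def
    by (rule exI[of _ g]) (auto simp: v_def g bij_betw_def inj_on_def image_image)
  ultimately show ?thesis by blast
qed


subsection \<open>Equivalence classes of words\<close>

lemma word_equiv_refl [simp]: "word_equiv w w"
  by (simp add: word_equiv_def)

lemma word_equiv_sym: "word_equiv w u \<Longrightarrow> word_equiv u w"
  by (auto simp: word_equiv_def intro: free_eq_sym)

lemma word_equiv_trans: "word_equiv w u \<Longrightarrow> word_equiv u v \<Longrightarrow> word_equiv w v"
  unfolding word_equiv_def by (blast intro: free_eq_trans)

lemma word_equiv_append:
  assumes "is_word w" "is_word w'" "is_word u" "is_word u'" "word_equiv w w'" "word_equiv u u'"
  shows "word_equiv (word_append w u) (word_append w' u')"
  using assms by (auto simp: word_equiv_def proj_word_append intro!: free_eq_append dest: set_proj_word)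

lemma word_class_eqI: "word_equiv w u \<Longrightarrow> word_class w = word_class u"
  unfolding word_class_def by (auto intro: word_equiv_trans word_equiv_sym)

lemma word_class_in_HEG:
  assumes "is_word w" shows "word_class w \<in> carrier HEG"
proof -
  obtain v :: "nat iword" where "is_word v" "word_iso v w" using ex_nat_word_iso[OF assms] by blast
  then have "word_class w = word_class v"
    using assms by (metis word_class_eqI word_iso_imp_equiv)
  then show ?thesis using \<open>is_word v\<close> by (auto simp: HEG_def)
qed

lemma HEG_cases:
  assumes "P \<in> carrier HEG"
  obtains w :: "nat iword" where "is_word w" "P = word_class w"
  using assms by (auto simp: HEG_def)

lemma HEG_mult:
  fixes w :: "'x iword" and u :: "'y iword"
  assumes "is_word w" "is_word u"
  shows "word_class w \<otimes>\<^bsub>HEG\<^esub> word_class u = word_class (word_append w u)"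
proof -
  have "word_class (word_append w' u') = word_class (word_append w u)"
    if "w' \<in> word_class w" "u' \<in> word_class u" for w' u' :: "nat iword"
    using that assms by (intro word_class_eqI word_equiv_append) (auto simp: word_class_def)
  moreover have "word_class w \<noteq> {}" "word_class u \<noteq> {}"
    using assms ex_nat_word_iso word_iso_imp_equiv unfolding word_class_def by blast+
  ultimately show ?thesis by (auto simp: HEG_def)
qed

theorem group_HEG: "group HEG"
proof (rule groupI)
  define e :: "nat iword" where "e = \<lparr> wdom = {}, wle = {}, wlab = (\<lambda>_. (1, True)) \<rparr>"
  have e: "is_word e" by (simp add: is_word_def e_def)
  have one: "\<one>\<^bsub>HEG\<^esub> = word_class e" by (simp add: HEG_def e_def)
  have proj_e: "proj_word n e = []" for n
    using proj_word_eq[OF e, of "[]" n] by (simp add: positions_def e_def)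
  show "\<one>\<^bsub>HEG\<^esub> \<in> carrier HEG" unfolding one using e by (rule word_class_in_HEG)
  fix P assume "P \<in> carrier HEG"
  then obtain w :: "nat iword" where w: "is_word w" "P = word_class w" by (rule HEG_cases)
  show "\<one>\<^bsub>HEG\<^esub> \<otimes>\<^bsub>HEG\<^esub> P = P"
    unfolding one w(2) HEG_mult[OF e w(1)]
    by (rule word_class_eqI) (simp add: word_equiv_def proj_word_append e w proj_e)
  show "\<exists>Q\<in>carrier HEG. Q \<otimes>\<^bsub>HEG\<^esub> P = \<one>\<^bsub>HEG\<^esub>"
  proof (rule bexI)
    note iw = is_word_inverse[OF w(1)]
    show "word_class (word_inverse w) \<in> carrier HEG" using iw by (rule word_class_in_HEG)
    show "word_class (word_inverse w) \<otimes>\<^bsub>HEG\<^esub> P = \<one>\<^bsub>HEG\<^esub>"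
      unfolding one w(2) HEG_mult[OF iw w(1)]
      by (rule word_class_eqI)
        (simp add: word_equiv_def proj_word_append iw w proj_e proj_word_inverse
          free_eq_inverse set_proj_word)
  qed
  fix Q assume "Q \<in> carrier HEG"
  then obtain u :: "nat iword" where u: "is_word u" "Q = word_class u" by (rule HEG_cases)
  show "P \<otimes>\<^bsub>HEG\<^esub> Q \<in> carrier HEG"
    unfolding w(2) u(2) HEG_mult[OF w(1) u(1)]
    by (intro word_class_in_HEG is_word_append w u)
  fix R assume "R \<in> carrier HEG"
  then obtain v :: "nat iword" where v: "is_word v" "R = word_class v" by (rule HEG_cases)
  show "P \<otimes>\<^bsub>HEG\<^esub> Q \<otimes>\<^bsub>HEG\<^esub> R = P \<otimes>\<^bsub>HEG\<^esub> (Q \<otimes>\<^bsub>HEG\<^esub> R)"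
    unfolding w(2) u(2) v(2)
    by (simp add: HEG_mult w u v is_word_append, rule word_class_eqI)
      (simp add: word_equiv_def proj_word_append is_word_append w u v)
qed

end

theory Submission
  imports Defs
begin

text \<open>A non-elliptic element has a power that is a long translation. Suppose that each
  \<open>HEG_tail n\<close> contains some \<open>h n\<close> with non-elliptic image \<open>\<eta> n\<close>. Infinite words solve every system
  \<open>x n = h n ^ p n * x (n + 1) ^ k n * h n ^ q n * x (n + 1) ^ k n\<close>. Depending on \<open>\<eta> n\<close> only, the
  exponents can be chosen so that the map \<open>g \<mapsto> \<eta> n ^ p n * g ^ k n * \<eta> n ^ q n * g ^ k n\<close> takes only
  loxodromic values and strictly increases, by at least 1, the displacement of a base point for
  loxodromic \<open>g\<close> (loxodromic in the quantitative sense of \<open>growing\<close> below). The displacement of the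
  image of \<open>x 0\<close> then exceeds every natural number. The choice of exponents rests on one dichotomy: an
  element either makes little backtracking with a translation or, by acylindricity, conjugates a
  bounded power of it to its inverse; two different exponents \<open>p n\<close>, \<open>q n\<close> deal with the
  second case.\<close>

section \<open>Gromov hyperbolic geometry\<close>

text \<open>The homomorphism is abstract, so nothing is known about the image of
  \<open>x (n + 1)\<close>, and the recursion has no last level at which an induction could start.
  The exponents at level \<open>n\<close> must therefore work for every element of the group,
  elliptic ones included, and must be fixed before any word is built. This is why all bounds below
  are uniform in the elements and points involved. Factorials serve the same end: they turn "some
  exponent up to \<open>N\<close>", which depends on the element, into a single exponent. Equal
  exponents could not succeed. Write \<open>H\<close> for the power of \<open>\<eta> n\<close> and
  \<open>y\<close> for the power of \<open>g\<close>. If \<open>H y H = y\<close>, then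
  \<open>H y H y = y y\<close>, and the translation has disappeared. With exponents in ratio two,
  \<open>H H y H y = H y y\<close>; here \<open>H\<close> commutes with \<open>y y\<close> and
  survives.\<close>

text \<open>The Gromov product of \<open>x\<close> and \<open>y\<close>, base point first. A small
  value says that \<open>w\<close> lies almost between \<open>x\<close> and \<open>y\<close>; this
  expresses betweenness without choosing geodesics.\<close>

definition gprod :: "'s::metric_space \<Rightarrow> 's \<Rightarrow> 's \<Rightarrow> real" where
  "gprod w x y = (dist x w + dist y w - dist x y) / 2"

lemma gprod_commute: "gprod w x y = gprod w y x"
  by (simp add: gprod_def dist_commute)

lemma gprod_nonneg: "0 \<le> gprod w x y"
  unfolding gprod_def using dist_triangle[of x y w] by (simp add: dist_commute)

lemma gprod_swap: "gprod w x y = dist w x - gprod x w y"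
  by (simp add: gprod_def dist_commute field_simps)

lemma gprod_lipschitz: "gprod w x y \<le> gprod w x' y + dist x x'"
  unfolding gprod_def using dist_triangle[of x w x'] dist_triangle[of x' y x]
  by (simp add: dist_commute field_simps)

lemma gprod_same [simp]: "gprod w w y = 0" "gprod w x w = 0"
  by (auto simp: gprod_def dist_commute)


subsection \<open>Thin triangles and the four-point inequality\<close>

lemma gprod_le_dist_segment:
  assumes "geodesic_segment A x y" "p \<in> A"
  shows "gprod w x y \<le> dist w p"
proof -
  obtain c t where c: "geodesic_from_to c x y" "t \<in> {0..dist x y}" "p = c t"
    using assms by (auto simp: geodesic_segment_def)
  then have "dist x p = t" "dist p y = dist x y - t"
    unfolding geodesic_from_to_def by (force dest: bspec[of _ _ 0] bspec[of _ _ "dist x y"])+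
  then show ?thesis
    unfolding gprod_def using dist_triangle[of x w p] dist_triangle[of y w p]
    by (simp add: dist_commute field_simps)
qed

lemma geodesic_segment_split:
  assumes "geodesic_segment A x y" "p \<in> A"
  shows "dist x y = dist x p + dist p y"
proof -
  obtain c t where c: "geodesic_from_to c x y" "t \<in> {0..dist x y}" "p = c t"
    using assms by (auto simp: geodesic_segment_def)
  then have "dist x p = t" "dist p y = dist x y - t"
    unfolding geodesic_from_to_def by (force dest: bspec[of _ _ 0] bspec[of _ _ "dist x y"])+
  then show ?thesis by simp
qed

text \<open>By connectedness: the points of \<open>A\<close> near \<open>B\<close> and those near
  \<open>C\<close> form two closed sets that cover an interval, so some point of \<open>A\<close> is
  near both other sides.\<close>

lemma thin_triangle_near_vertex:
  fixes x y w :: "'s::metric_space"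
  assumes thin: "thin_triangles \<delta> TYPE('s)"
    and A: "geodesic_segment A x y" and B: "geodesic_segment B y w" and C: "geodesic_segment C x w"
  shows "\<exists>p\<in>A. dist p w \<le> gprod w x y + 2 * \<delta> + 2"
proof -
  obtain c where c: "geodesic_from_to c x y" and Ac: "A = c ` {0..dist x y}"
    using A by (auto simp: geodesic_segment_def)
  have isom: "dist (c s) (c t) = \<bar>s - t\<bar>" if "s \<in> {0..dist x y}" "t \<in> {0..dist x y}" for s t
    using c that by (auto simp: geodesic_from_to_def)
  have cont: "continuous_on {0..dist x y} c"
    unfolding continuous_on_iff
  proof (intro ballI allI impI)
    fix t e :: real assume "t \<in> {0..dist x y}" "0 < e"
    then show "\<exists>d>0. \<forall>s\<in>{0..dist x y}. dist s t < d \<longrightarrow> dist (c s) (c t) < e"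
      by (intro exI[of _ e]) (auto simp: isom dist_real_def)
  qed
  have xC: "x \<in> C" and yB: "y \<in> B"
    using B C by (auto simp: geodesic_segment_def geodesic_from_to_def image_iff intro!: bexI[of _ 0])
  define P where "P X = {t \<in> {0..dist x y}. infdist (c t) X \<le> \<delta>}" for X
  have closed: "closed (P X)" for X
    unfolding P_def
    by (intro continuous_on_closed_Collect_le continuous_intros cont)
  have \<delta>: "0 \<le> \<delta>"
  proof -
    have "x \<in> A" using c Ac by (auto simp: geodesic_from_to_def image_iff intro!: bexI[of _ 0])
    then obtain q where "dist x q \<le> \<delta>" using thin A B C unfolding thin_triangles_def by blast
    then show ?thesis using zero_le_dist[of x q] by linarith
  qed
  have cover: "{0..dist x y} \<subseteq> P B \<union> P C"
  proof
    fix t assume t: "t \<in> {0..dist x y}"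
    then have "c t \<in> A" using Ac by auto
    then obtain q where q: "q \<in> B \<union> C" "dist (c t) q \<le> \<delta>"
      using thin A B C unfolding thin_triangles_def by blast
    then show "t \<in> P B \<union> P C"
      using t by (auto simp: P_def intro: order_trans[OF infdist_le])
  qed
  have "0 \<in> P C" "dist x y \<in> P B"
    using c xC yB \<delta> by (auto simp: P_def geodesic_from_to_def)
  moreover have "P C \<subseteq> {0..dist x y}" "P B \<subseteq> {0..dist x y}" by (auto simp: P_def)
  moreover have "connected {0..dist x y}" by simp
  ultimately have "P B \<inter> P C \<inter> {0..dist x y} \<noteq> {}"
    using closed[of B] closed[of C] cover unfolding connected_closed by blast
  then obtain t where t: "t \<in> {0..dist x y}" "infdist (c t) B \<le> \<delta>" "infdist (c t) C \<le> \<delta>"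
    by (auto simp: P_def)
  \<comment> \<open>The distances to \<open>B\<close> and \<open>C\<close> are infima; the slack 1
    given away for each of them ends up as the \<open>+ 2\<close> of the bound.\<close>
  have near: "\<exists>q\<in>X. dist (c t) q < \<delta> + 1" if "X \<noteq> {}" "infdist (c t) X \<le> \<delta>" for X
  proof (rule ccontr)
    assume "\<not> ?thesis"
    then have "\<delta> + 1 \<le> infdist (c t) X"
      using that(1) by (auto simp: infdist_def intro!: cINF_greatest)
    then show False using that(2) by simp
  qed
  obtain q where q: "q \<in> B" "dist (c t) q < \<delta> + 1" using near[OF _ t(2)] yB by blast
  obtain r where r: "r \<in> C" "dist (c t) r < \<delta> + 1" using near[OF _ t(3)] xC by blast
  have pA: "c t \<in> A" using t Ac by auto
  have "dist y w = dist y q + dist q w" "dist x w = dist x r + dist r w"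
    "dist x y = dist x (c t) + dist (c t) y"
    using geodesic_segment_split A B C q r pA by blast+
  then have "dist (c t) w \<le> gprod w x y + 2 * \<delta> + 2"
    unfolding gprod_def
    using q(2) r(2) dist_triangle[of y "c t" q] dist_triangle[of "c t" w q]
      dist_triangle[of x "c t" r] dist_triangle[of "c t" w r]
    by (simp add: dist_commute field_simps)
  then show ?thesis using pA by blast
qed

text \<open>A point \<open>p\<close> of the side from \<open>x\<close> to \<open>z\<close> almost
  realises \<open>gprod w x z\<close> as its distance from \<open>w\<close>. It is near one of the
  other two sides, whose points are no closer to \<open>w\<close> than the corresponding
  product.\<close>

lemma thin_triangles_four_point:
  fixes w x y z :: "'s::metric_space"
  assumes thin: "thin_triangles \<delta> TYPE('s)" and geod: "geodesic_space TYPE('s)"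
  shows "min (gprod w x y) (gprod w y z) \<le> gprod w x z + (3 * \<delta> + 2)"
proof -
  have seg: "\<exists>A. geodesic_segment A a b" for a b :: 's
    using geod by (auto simp: geodesic_space_def)
  obtain A B C where A: "geodesic_segment A x y" and B: "geodesic_segment B y z"
    and C: "geodesic_segment C x z" using seg by meson
  obtain B' C' where "geodesic_segment B' z w" "geodesic_segment C' x w" using seg by meson
  with C obtain p where p: "p \<in> C" "dist p w \<le> gprod w x z + 2 * \<delta> + 2"
    using thin_triangle_near_vertex[OF thin] by blast
  then obtain q where q: "q \<in> A \<union> B" "dist p q \<le> \<delta>"
    using thin A B C unfolding thin_triangles_def by blast
  then have "min (gprod w x y) (gprod w y z) \<le> dist w q"
    using gprod_le_dist_segment[OF A, of q w] gprod_le_dist_segment[OF B, of q w] by auto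
  then show ?thesis using p q dist_triangle[of w q p] by (simp add: dist_commute)
qed


subsection \<open>Geometry from the four-point inequality\<close>

text \<open>From here on thin triangles enter only through this inequality, and geodesics only as
  points at prescribed distances from two ends. \<open>\<delta>\<close> is the constant of the
  inequality, not that of the triangles.\<close>

locale four_point_space =
  fixes \<delta> :: real and space_type :: "'s::metric_space itself"
  assumes four_point: "min (gprod w x y) (gprod w y z) \<le> gprod (w::'s) x z + \<delta>"
    and interpolation: "0 \<le> t \<Longrightarrow> t \<le> dist x y \<Longrightarrow> \<exists>p::'s. dist x p = t \<and> dist p y = dist x y - t"
begin

lemma delta_nonneg: "0 \<le> \<delta>"
  using four_point[of undefined undefined undefined undefined] by simp

lemma four_point_dist:
  fixes x y z w :: 's
  shows "dist x y + dist z w \<le> max (dist x z + dist y w) (dist y z + dist x w) + 2 * \<delta>"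
  using four_point[of w x z y] dist_commute[of z y] by (auto simp: gprod_def min_def max_def field_simps split: if_splits)

text \<open>Ultrametric reasoning with error \<open>\<delta>\<close>: if \<open>y\<close> and
  \<open>z\<close> have a large product, then \<open>y\<close> may replace \<open>z\<close> in a
  small one.\<close>

lemma gprod_le_of_large:
  fixes x y z w :: 's
  assumes "gprod w x z \<le> c" "c + \<delta> < gprod w y z"
  shows "gprod w x y \<le> c + \<delta>"
  using four_point[of w x y z] assms by auto

lemma gprod_le_of_large2:
  fixes x y z w :: 's
  assumes "gprod w z x \<le> c" "c + \<delta> < gprod w y z"
  shows "gprod w y x \<le> c + \<delta>"
  using gprod_le_of_large[of w x z c y] assms by (simp add: gprod_commute)

lemma dist_le_of_between:
  fixes p q x z :: 's
  assumes "gprod p x z \<le> \<eta>" "gprod q x z \<le> \<eta>"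
  shows "dist p q \<le> \<bar>dist x p - dist x q\<bar> + 2 * \<eta> + 2 * \<delta>"
  using four_point_dist[of p q x z] assms by (auto simp: gprod_def dist_commute field_simps)

lemma between_transfer:
  fixes p x y z :: 's
  assumes "gprod p x y \<le> \<eta>" "dist x p \<le> gprod x y z" "0 \<le> \<eta>"
  shows "gprod p x z \<le> \<eta> + \<delta>"
  using four_point[of x p y z] assms gprod_swap[of x p y] gprod_swap[of x p z] by auto

text \<open>Local to global for broken lines with long sides and small turns. If the far end has a
  small product at the next vertex, it has a large product with that vertex as seen from the present
  one, and may replace it at the cost of one \<open>\<delta>\<close>. Each induction step restarts
  from the local bound \<open>c\<close>, so errors do not add up; the second \<open>\<delta>\<close>
  comes from joining both directions.\<close>

lemma gprod_chain:
  fixes y :: "nat \<Rightarrow> 's"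
  assumes prod: "\<And>i. 0 < i \<Longrightarrow> i < n \<Longrightarrow> gprod (y i) (y (i - 1)) (y (i + 1)) \<le> c"
    and len: "\<And>i. i < n \<Longrightarrow> 2 * c + 3 * \<delta> < dist (y i) (y (i + 1))"
    and c: "0 \<le> c" and ijk: "i \<le> j" "j \<le> k" "k \<le> n"
  shows "gprod (y j) (y i) (y k) \<le> c + 2 * \<delta>"
proof -
  have right: "0 < i \<Longrightarrow> i + 1 + d \<le> n \<Longrightarrow> gprod (y i) (y (i - 1)) (y (i + 1 + d)) \<le> c + \<delta>" for i d
  proof (induction d arbitrary: i)
    case 0
    then show ?case using prod[of i] delta_nonneg by simp
  next
    case (Suc d)
    have "gprod (y (i + 1)) (y i) (y (i + 1 + 1 + d)) \<le> c + \<delta>"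
      using Suc.IH[of "i + 1"] Suc.prems by simp
    then have "c + \<delta> < gprod (y i) (y (i + 1 + Suc d)) (y (i + 1))"
      using len[of i] Suc.prems gprod_swap[of "y i" "y (i + 1)" "y (i + 1 + Suc d)"]
      using delta_nonneg by (simp add: gprod_commute)
    then show ?case
      using gprod_le_of_large prod[of i] Suc.prems by simp
  qed
  have left: "i < j \<Longrightarrow> j < n \<Longrightarrow> gprod (y j) (y i) (y (j + 1)) \<le> c + \<delta>" for i j
  proof (induction j)
    case (Suc j)
    have "gprod (y (Suc j)) (y j) (y (j + 2)) \<le> c"
      using prod[of "Suc j"] Suc.prems by simp
    moreover have "c + \<delta> < gprod (y (Suc j)) (y i) (y j)" if "i < j"
      using len[of j] Suc that delta_nonneg gprod_swap[of "y (Suc j)" "y j" "y i"]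
      by (simp add: gprod_commute dist_commute)
    ultimately show ?case
      using gprod_le_of_large2[of "y (Suc j)" "y j" "y (j + 2)" c "y i"] Suc.prems delta_nonneg
      by (cases "i = j") auto
  qed simp
  show ?thesis
  proof (cases "i < j \<and> j < k")
    case False
    then have "j = i \<or> j = k" using ijk by auto
    then show ?thesis using c delta_nonneg by auto
  next
    case True
    have 1: "gprod (y j) (y (j - 1)) (y k) \<le> c + \<delta>"
      using right[of j "k - j - 1"] True ijk by simp
    show ?thesis
    proof (cases "i = j - 1")
      case True
      then show ?thesis using 1 delta_nonneg by simp
    next
      case False
      have "gprod (y (j - 1)) (y i) (y j) \<le> c + \<delta>"
        using left[of i "j - 1"] True False ijk by (cases j) auto
      then have "c + \<delta> + \<delta> < gprod (y j) (y i) (y (j - 1))"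
        using len[of "j - 1"] True ijk gprod_swap[of "y j" "y (j - 1)" "y i"]
        by (cases j) (auto simp: gprod_commute dist_commute)
      then show ?thesis
        using gprod_le_of_large2[OF 1] by (auto simp: algebra_simps)
    qed
  qed
qed

lemma displacement_convex:
  fixes a b p :: 's and f :: "'s \<Rightarrow> 's"
  assumes isom: "\<And>x y. dist (f x) (f y) = dist x y"
    and "gprod p a b \<le> \<eta>" "dist a (f a) \<le> C" "dist b (f b) \<le> C"
  shows "dist p (f p) \<le> C + 2 * \<eta> + 4 * \<delta>"
proof -
  have "dist (f p) b + dist a b \<le> max (dist p a + dist b (f b)) (dist p b + dist (f a) b) + 2 * \<delta>"
    using four_point_dist[of "f p" b "f b" "f a"] isom[of p a] isom[of p b] isom[of a b]
    by (auto simp: dist_commute max_def split: if_splits)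
  moreover have "dist (f a) b \<le> dist a (f a) + dist a b"
    using dist_triangle[of "f a" b a] by (simp add: dist_commute)
  moreover have "dist p (f p) + dist a b \<le> max (dist p a + dist (f p) b) (dist p b + dist (f p) a) + 2 * \<delta>"
    using four_point_dist[of p "f p" a b] by (auto simp: dist_commute max_def split: if_splits)
  moreover have "dist (f p) a + dist a b \<le> max (dist p b + dist a (f a)) (dist p a + dist (f b) a) + 2 * \<delta>"
    using four_point_dist[of "f p" a "f a" "f b"] isom[of p a] isom[of p b] isom[of b a]
    by (auto simp: dist_commute max_def split: if_splits)
  moreover have "dist (f b) a \<le> dist b (f b) + dist a b"
    using dist_triangle[of "f b" a b] by (simp add: dist_commute)
  moreover have "dist p a + dist p b - dist a b \<le> 2 * \<eta>"
    using assms(2) by (simp add: gprod_def dist_commute)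
  moreover have "dist a b \<le> dist p a + dist p b" "dist p a \<le> dist p b + dist a b"
     "dist p b \<le> dist p a + dist a b"
    by (metis dist_triangle dist_commute)+
  ultimately show ?thesis using assms(3,4) delta_nonneg
    by (auto simp: max_def split: if_splits)
qed

text \<open>For isometries \<open>f\<close> and \<open>C > 0\<close> \<open>growing C f x\<close> implies that the orbit of \<open>x\<close> is a
  quasi-geodesic. Every isometry violating it almost fixes a midpoint of \<open>x\<close> and \<open>f x\<close>.\<close>

definition growing :: "real \<Rightarrow> ('s \<Rightarrow> 's) \<Rightarrow> 's \<Rightarrow> bool" where
  "growing C f x \<longleftrightarrow> dist x (f x) + 2 * \<delta> + C \<le> dist x (f (f x))"

text \<open>A lower bound for the stable translation length. Since \<open>D\<close> may depend on
  the point, the notion has no base point and is invariant under conjugation.\<close>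

definition translates :: "('s \<Rightarrow> 's) \<Rightarrow> real \<Rightarrow> bool" where
  "translates f t \<longleftrightarrow> (\<forall>x. \<exists>D. \<forall>n::nat. real n * t - D \<le> dist x ((f ^^ n) x))"

section \<open>Growing orbits against almost fixed midpoints\<close>

text \<open>The four-point inequality for \<open>x\<close> and the iterates \<open>n\<close>,
  \<open>n + 1\<close>, \<open>n + 2\<close> leaves two alternatives. One says that the previous
  step lost distance, which the induction hypothesis excludes; the other is the claim.\<close>

lemma growing_increment:
  assumes isom: "\<And>x y. dist (f x) (f y) = dist x y" and g: "growing C f x" and C: "0 < C"
  shows "dist x ((f ^^ n) x) + C \<le> dist x ((f ^^ Suc n) x)"
proof -
  have iter: "dist ((f ^^ n) a) ((f ^^ n) b) = dist a b" for n a b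
    by (induction n) (auto simp: isom)
  have "n \<ge> 1 \<Longrightarrow> dist x ((f ^^ n) x) + C \<le> dist x ((f ^^ Suc n) x)"
  proof (induction n rule: nat_induct_at_least)
    case base
    then show ?case using g delta_nonneg by (simp add: growing_def)
  next
    case (Suc n)
    have "dist ((f ^^ n) x) ((f ^^ Suc n) x) = dist x (f x)"
      "dist ((f ^^ Suc n) x) ((f ^^ Suc (Suc n)) x) = dist x (f x)"
      "dist ((f ^^ n) x) ((f ^^ Suc (Suc n)) x) = dist x (f (f x))"
      using iter[of n x "f x"] iter[of "Suc n" x "f x"] iter[of n x "f (f x)"]
      by (simp_all add: funpow_swap1)
    then show ?case
      using Suc.IH g C delta_nonneg four_point_dist[of x "(f ^^ Suc n) x" "(f ^^ n) x" "(f ^^ Suc (Suc n)) x"]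
      unfolding growing_def by (simp only: max_def dist_commute) (simp split: if_splits)
  qed
  moreover have "dist x x + C \<le> dist x (f x)"
    using g dist_triangle[of x "f (f x)" "f x"] isom[of x "f x"] delta_nonneg
    by (simp add: growing_def)
  ultimately show ?thesis by (cases n) auto
qed

lemma growing_translates:
  assumes isom: "\<And>x y. dist (f x) (f y) = dist x y" and g: "growing C f x" and C: "0 < C"
  shows "real n * C \<le> dist x ((f ^^ n) x)" "translates f C"
proof -
  show 1: "real n * C \<le> dist x ((f ^^ n) x)" for n
  proof (induction n)
    case (Suc n)
    then show ?case using growing_increment[OF assms, of n] by (simp add: algebra_simps)
  qed simp
  have iter: "dist ((f ^^ n) a) ((f ^^ n) b) = dist a b" for n a b
    by (induction n) (auto simp: isom)
  have "real n * C - 2 * dist x z \<le> dist z ((f ^^ n) z)" for n z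
    using 1[of n] dist_triangle[of x "(f ^^ n) x" z] dist_triangle[of z "(f ^^ n) x" "(f ^^ n) z"]
      iter[of n x z] by (simp add: dist_commute)
  then show "translates f C" unfolding translates_def by blast
qed

lemma translates_displacement:
  assumes isom: "\<And>x y. dist (f x) (f y) = dist x y" and "translates f t"
  shows "t \<le> dist x (f x)"
proof -
  have iter: "dist ((f ^^ n) a) ((f ^^ n) b) = dist a b" for n a b
    by (induction n) (auto simp: isom)
  have upper: "dist x ((f ^^ n) x) \<le> real n * dist x (f x)" for n
  proof (induction n)
    case (Suc n)
    have "dist ((f ^^ n) x) ((f ^^ Suc n) x) = dist x (f x)"
      using iter[of n x "f x"] by (simp add: funpow_swap1)
    then show ?case
      using Suc dist_triangle[of x "(f ^^ Suc n) x" "(f ^^ n) x"] by (simp add: algebra_simps)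
  qed simp
  obtain D where D: "\<And>n::nat. real n * t - D \<le> dist x ((f ^^ n) x)"
    using assms(2) unfolding translates_def by blast
  show ?thesis
  proof (rule ccontr)
    assume "\<not> ?thesis"
    then have pos: "0 < t - dist x (f x)" by simp
    obtain n where "D < real n * (t - dist x (f x))" using pos reals_Archimedean3 by blast
    then show False using D[of n] upper[of n] by (simp add: algebra_simps)
  qed
qed

text \<open>\<open>p\<close> and \<open>f p\<close> are midpoints of consecutive orbit segments. If
  the orbit turns back at \<open>f x\<close>, the segments run together from there and their
  midpoints nearly meet; otherwise the gain of the second step controls their distance.\<close>

lemma midpoint_displacement:
  fixes x p :: 's
  assumes isom: "\<And>x y. dist (f x) (f y) = dist x y"
    and p: "dist x p = dist x (f x) / 2" "dist p (f x) = dist x (f x) / 2"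
  shows "dist p (f p) \<le> max 0 (dist x (f (f x)) - dist x (f x)) + 4 * \<delta>"
proof -
  have "dist x (f p) + dist (f x) (f (f x)) \<le> max (dist x (f x) + dist (f p) (f (f x))) (dist x (f (f x)) + dist (f p) (f x)) + 2 * \<delta>"
    using four_point_dist[of x "f p" "f x" "f (f x)"] by (auto simp: dist_commute max_def split: if_splits)
  moreover have "dist x (f x) + dist p (f p) \<le> max (dist x p + dist (f x) (f p)) (dist x (f p) + dist (f x) p) + 2 * \<delta>"
    using four_point_dist[of x "f x" p "f p"] by (auto simp: dist_commute max_def split: if_splits)
  ultimately show ?thesis
    using p isom[of x "f x"] isom[of p "f x"] isom[of x p] delta_nonneg
    by (auto simp: dist_commute max_def field_simps split: if_splits)
qed

lemma midpoint_exists: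
  obtains p :: 's where "dist x p = dist x y / 2" "dist p y = dist x y / 2"
  using interpolation[of "dist x y / 2" x y] by auto

text \<open>The midpoint is moved by at least \<open>t\<close>; \<open>4 * \<delta>\<close> is lost
  in \<open>midpoint_displacement\<close> and \<open>2 * \<delta>\<close> in the definition of
  \<open>growing\<close>. As \<open>x\<close> is arbitrary, this also carries growth from one base
  point to another.\<close>

lemma translates_growing:
  assumes isom: "\<And>x y. dist (f x) (f y) = dist x y" and t: "translates f t" "4 * \<delta> < t"
  shows "growing (t - 6 * \<delta>) f x"
proof -
  obtain p where "dist x p = dist x (f x) / 2" "dist p (f x) = dist x (f x) / 2"
    using midpoint_exists by blast
  from midpoint_displacement[OF isom this] translates_displacement[OF isom t(1), of p]
  show ?thesis using t(2) by (auto simp: growing_def max_def split: if_splits)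
qed

lemma not_growing_almost_fixed:
  assumes isom: "\<And>x y. dist (f x) (f y) = dist x y" and "\<not> growing C f x" "0 \<le> C"
  obtains p where "dist p (f p) \<le> C + 6 * \<delta>" "dist x p = dist x (f x) / 2"
proof -
  obtain p where p: "dist x p = dist x (f x) / 2" "dist p (f x) = dist x (f x) / 2"
    using midpoint_exists by blast
  from midpoint_displacement[OF isom this] assms(2,3) delta_nonneg
  have "dist p (f p) \<le> C + 6 * \<delta>" by (auto simp: growing_def max_def split: if_splits)
  with p(1) show ?thesis by (rule that[rotated])
qed

end


section \<open>Acylindrical actions\<close>

locale acylindrical_space = four_point_space \<delta> space_type + group G
  for \<delta> :: real and space_type :: "'s::metric_space itself" and G :: "('g, 'm) monoid_scheme" (structure) +
  fixes act :: "'g \<Rightarrow> 's \<Rightarrow> 's"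
  assumes isometric: "isometric_action G act" and acylindrical: "acylindrical_action G act"
begin

section \<open>The action and the powers of one element\<close>

lemma act_mult: "g \<in> carrier G \<Longrightarrow> h \<in> carrier G \<Longrightarrow> act (g \<otimes> h) x = act g (act h x)"
  using isometric group_action.composition_rule[of G UNIV act x g h]
  by (simp add: isometric_action_def)

lemma act_one [simp]: "act \<one> x = x"
proof -
  have "group_action G UNIV act" using isometric by (simp add: isometric_action_def)
  from group_action.id_eq_one[OF this] show ?thesis by (metis restrict_UNIV)
qed

lemma dist_act [simp]: "g \<in> carrier G \<Longrightarrow> dist (act g x) (act g y) = dist x y"
  using isometric by (simp add: isometric_action_def)

lemma gprod_act [simp]: "g \<in> carrier G \<Longrightarrow> gprod (act g x) (act g y) (act g z) = gprod x y z"
  by (simp add: gprod_def)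

lemma act_inv [simp]:
  assumes "g \<in> carrier G" shows "act (inv g) (act g x) = x" "act g (act (inv g) x) = x"
  using assms act_mult[of "inv g" g x] act_mult[of g "inv g" x] by simp_all

lemma dist_act_inv: "g \<in> carrier G \<Longrightarrow> dist x (act (inv g) y) = dist (act g x) y"
  using dist_act[of g x "act (inv g) y"] by simp

lemma funpow_act: "g \<in> carrier G \<Longrightarrow> (act g ^^ n) x = act (g [^] n) x"
  by (induction n) (simp, simp only: nat_pow_Suc2 funpow.simps o_apply act_mult nat_pow_closed)

lemma growing_pow_increment:
  assumes "g \<in> carrier G" "growing C (act g) x" "0 < C"
  shows "dist x (act (g [^] k) x) + real m * C \<le> dist x (act (g [^] (k + m)) x)"
proof (induction m)
  case (Suc m)
  have "dist x (act (g [^] (k + m)) x) + C \<le> dist x (act (g [^] Suc (k + m)) x)"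
    using growing_increment[of "act g" C x "k + m"] assms by (simp only: funpow_act dist_act)
  then show ?case using Suc by (simp add: algebra_simps)
qed simp

lemma act_int_pow_add:
  "u \<in> carrier G \<Longrightarrow> act (u [^] (i::int)) (act (u [^] (j::int)) x) = act (u [^] (i + j)) x"
  by (simp add: act_mult[symmetric] int_pow_mult)

lemma act_int_pow_0 [simp]: "act (u [^] (0::int)) x = x"
  by simp

lemma dist_int_pow:
  assumes "u \<in> carrier G"
  shows "dist (act (u [^] (i::int)) x) (act (u [^] (j::int)) y) = dist x (act (u [^] (j - i)) y)"
  using dist_act[of "u [^] i" x "act (u [^] (j - i)) y"] assms
  by (simp add: act_int_pow_add)

lemma gprod_int_pow:
  assumes "u \<in> carrier G"
  shows "gprod (act (u [^] (i::int)) x) (act (u [^] (j::int)) y) (act (u [^] (k::int)) z)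
    = gprod x (act (u [^] (j - i)) y) (act (u [^] (k - i)) z)"
  using gprod_act[of "u [^] i" x "act (u [^] (j - i)) y" "act (u [^] (k - i)) z"] assms
  by (simp add: act_int_pow_add)

lemma translatesI:
  assumes "g \<in> carrier G" "\<And>n::nat. real n * t - D \<le> dist x (act (g [^] n) x)"
  shows "translates (act g) t"
  unfolding translates_def
proof
  fix z
  have "real n * t - (D + 2 * dist x z) \<le> dist z ((act g ^^ n) z)" for n
    using assms(2)[of n] dist_triangle[of x "act (g [^] n) x" z]
      dist_triangle[of z "act (g [^] n) x" "act (g [^] n) z"] dist_act[of "g [^] n" z x] assms(1)
    by (simp add: funpow_act dist_commute)
  then show "\<exists>D. \<forall>n::nat. real n * t - D \<le> dist z ((act g ^^ n) z)" by blast
qed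

lemma translatesD:
  assumes "g \<in> carrier G" "translates (act g) t"
  obtains D where "\<And>n::nat. real n * t - D \<le> dist x (act (g [^] n) x)"
  using assms by (auto simp: translates_def funpow_act)

text \<open>The form in which acylindricity is applied: among \<open>N + 1\<close> elements that
  almost fix two distant points two agree, which gives a relation in the group.\<close>

lemma acylindrical_pigeonhole:
  assumes "0 < \<epsilon>"
  obtains R :: real and N :: nat where "0 < R" "0 < N"
    "\<And>p q (\<gamma> :: nat \<Rightarrow> 'g). R \<le> dist p q \<Longrightarrow>
      (\<And>i. i \<le> N \<Longrightarrow> \<gamma> i \<in> carrier G \<and> dist p (act (\<gamma> i) p) \<le> \<epsilon> \<and> dist q (act (\<gamma> i) q) \<le> \<epsilon>) \<Longrightarrow>
      \<exists>i j. i < j \<and> j \<le> N \<and> \<gamma> i = \<gamma> j"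
proof -
  obtain R :: real and N :: nat where RN: "0 < R" "0 < N"
    "\<And>p q. R \<le> dist p q \<Longrightarrow>
       finite {g \<in> carrier G. dist p (act g p) \<le> \<epsilon> \<and> dist q (act g q) \<le> \<epsilon>} \<and>
       card {g \<in> carrier G. dist p (act g p) \<le> \<epsilon> \<and> dist q (act g q) \<le> \<epsilon>} \<le> N"
    using acylindrical assms unfolding acylindrical_action_def by blast
  show ?thesis
  proof (rule that[OF RN(1,2)])
    fix p q and \<gamma> :: "nat \<Rightarrow> 'g"
    let ?S = "{g \<in> carrier G. dist p (act g p) \<le> \<epsilon> \<and> dist q (act g q) \<le> \<epsilon>}"
    assume "R \<le> dist p q" and \<gamma>: "\<And>i. i \<le> N \<Longrightarrow> \<gamma> i \<in> carrier G \<and> dist p (act (\<gamma> i) p) \<le> \<epsilon> \<and> dist q (act (\<gamma> i) q) \<le> \<epsilon>"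
    then have S: "finite ?S" "card ?S \<le> N" using RN(3) by blast+
    have "\<not> inj_on \<gamma> {..N}"
    proof
      assume "inj_on \<gamma> {..N}"
      then have "card {..N} \<le> card ?S"
        using S(1) \<gamma> by (intro card_inj_on_le) auto
      then show False using S(2) by simp
    qed
    then obtain i j where "i \<le> N" "j \<le> N" "i \<noteq> j" "\<gamma> i = \<gamma> j" by (auto simp: inj_on_def)
    then show "\<exists>i j. i < j \<and> j \<le> N \<and> \<gamma> i = \<gamma> j"
      by (metis linorder_neqE_nat)
  qed
qed


subsection \<open>Quasi-axes\<close>

text \<open>The points \<open>u [^] i\<close> applied to \<open>p\<close> lie on a quasi-axis of \<open>u\<close> up to an error depending on
  \<open>\<delta>\<close> alone. The constant 100 is any sufficiently large number.\<close>

definition axis_point :: "'g \<Rightarrow> 's \<Rightarrow> 's \<Rightarrow> bool" where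
  "axis_point u x p \<longleftrightarrow> u \<in> carrier G \<and> growing (100 * \<delta> + 1) (act u) x \<and>
     dist x p = dist x (act u x) / 2 \<and> dist p (act u x) = dist x (act u x) / 2"

lemma axis_point_exists:
  assumes "u \<in> carrier G" "growing (100 * \<delta> + 1) (act u) x"
  obtains p where "axis_point u x p"
  using midpoint_exists[of x "act u x"] assms unfolding axis_point_def by metis

text \<open>The broken line goes from \<open>x\<close> to \<open>p\<close>, along the translates of
  \<open>p\<close>, and out to \<open>u [^] b\<close> applied to \<open>x\<close>. The orbit of
  \<open>x\<close> alone would not do: \<open>x\<close> may be far from the axis, and the orbit then
  backtracks by an amount depending on \<open>x\<close>. Here only the two end segments feel that
  distance. All turns are at most \<open>5 * \<delta>\<close>, and \<open>gprod_chain\<close> adds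
  \<open>2 * \<delta>\<close>.\<close>

lemma axis_chain:
  assumes "axis_point u x p" "1 \<le> b" "i \<le> j" "j \<le> k" "k \<le> b + 1"
  defines "y \<equiv> \<lambda>i. if i = 0 then x else if i \<le> b then act (u [^] (int i - 1)) p else act (u [^] int b) x"
  shows "gprod (y j) (y i) (y k) \<le> 7 * \<delta>" 
    and "1 + 100 * \<delta> \<le> dist p (act u p)"
proof -
  have u: "u \<in> carrier G" and g: "growing (100 * \<delta> + 1) (act u) x"
    and p: "dist x p = dist x (act u x) / 2" "dist p (act u x) = dist x (act u x) / 2"
    using assms(1) by (auto simp: axis_point_def)
  have isom: "dist (act u a) (act u b) = dist a b" for a b using u by simp
  \<comment> \<open>The largest constant with which \<open>u\<close> is growing at \<open>x\<close>.
    The exact value matters: \<open>p\<close> is moved by at most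
    \<open>\<tau> + 6 * \<delta>\<close>, and its second step gains at least
    \<open>\<tau> - 4 * \<delta>\<close>, so the turn is at most half of
    \<open>10 * \<delta>\<close>.\<close>
  define \<tau> where "\<tau> = dist x (act u (act u x)) - dist x (act u x) - 2 * \<delta>"
  have \<tau>: "100 * \<delta> + 1 \<le> \<tau>" using g by (simp add: growing_def \<tau>_def)
  have "growing \<tau> (act u) x" by (simp add: growing_def \<tau>_def)
  then have tr: "translates (act u) \<tau>"
    using growing_translates(2)[OF isom] \<tau> delta_nonneg by simp
  have T: "\<tau> \<le> dist p (act u p)" using translates_displacement[OF isom tr] .
  then show "1 + 100 * \<delta> \<le> dist p (act u p)" using \<tau> by simp
  have T2: "dist p (act u p) \<le> \<tau> + 6 * \<delta>"
    using midpoint_displacement[OF isom p] \<tau> delta_nonneg by (simp add: \<tau>_def)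
  have "dist p (act u p) + \<tau> - 4 * \<delta> \<le> dist p (act u (act u p))"
    using translates_growing[OF isom tr, of p] \<tau> delta_nonneg by (simp add: growing_def)
  then have axial: "gprod (act u p) p (act u (act u p)) \<le> 5 * \<delta>"
    using T2 u by (simp add: gprod_def dist_commute)
  have r: "dist p (act u p) \<le> 2 * dist x p"
    using dist_triangle[of p "act u p" "act u x"] p u dist_act[of u x p] by (simp add: dist_commute)
  have mid: "gprod p x (act u x) = 0" using p by (simp add: gprod_def dist_commute)
  have "gprod p (act u p) (act u x) = dist p (act u p) / 2"
    using p dist_act[OF u, of p x] by (simp add: gprod_def dist_commute)
  then have start: "gprod p x (act u p) \<le> \<delta>"
    using gprod_le_of_large2[of p "act u x" "act u p" 0 x] gprod_le_of_large[of p x "act u x" 0 "act u p"] mid T \<tau> delta_nonneg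
    by (simp add: gprod_commute)
  have e0: "dist (act (inv u) p) x = dist p (act u x)" "dist p (act (inv u) p) = dist p (act u p)"
    using dist_act_inv[OF u, of x p] dist_act_inv[OF u, of p p] by (simp_all add: dist_commute)
  then have "gprod p (act (inv u) p) x = dist p (act u p) / 2"
    using p by (simp add: gprod_def dist_commute)
  then have "gprod p (act u x) (act (inv u) p) \<le> \<delta>"
    using gprod_le_of_large[of p "act u x" x 0 "act (inv u) p"] mid T \<tau> delta_nonneg
    by (simp add: gprod_commute)
  then have fin: "gprod (act u p) p (act u (act u x)) \<le> \<delta>"
    using gprod_act[OF u, of p "act (inv u) p" "act u x"] u by (simp add: gprod_commute)
  have pow: "act u z = act (u [^] (1::int)) z" for z
    using u by (simp add: int_pow_1)
  note pow = pow act_int_pow_add[OF u]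
  show "gprod (y j) (y i) (y k) \<le> 7 * \<delta>"
  proof -
    have "gprod (y j) (y i) (y k) \<le> 5 * \<delta> + 2 * \<delta>"
    proof (rule gprod_chain[of "b + 1"])
      fix i assume i: "0 < i" "i < b + 1"
      have "gprod p (act (u [^] (-1::int)) p) (act (u [^] (1::int)) p) \<le> 5 * \<delta>"
        using axial gprod_int_pow[OF u, of 1 p 0 p 2 p] by (simp add: pow)
      moreover have "gprod p (act (u [^] (-1::int)) p) (act (u [^] (1::int)) x) \<le> 5 * \<delta>"
        using fin delta_nonneg gprod_int_pow[OF u, of 1 p 0 p 2 x] by (simp add: pow)
      moreover have "gprod p x (act (u [^] (1::int)) p) \<le> 5 * \<delta>"
        using start delta_nonneg by (simp add: pow)
      moreover have "gprod p x (act (u [^] (1::int)) x) \<le> 5 * \<delta>"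
        using mid delta_nonneg by (simp add: pow)
      moreover have "gprod (y i) (y (i - 1)) (y (i + 1)) = gprod p
          (if i = 1 then x else act (u [^] (-1::int)) p)
          (if i < b then act (u [^] (1::int)) p else act (u [^] (1::int)) x)"
      proof -
        have "y i = act (u [^] (int i - 1)) p" using i by (simp add: y_def)
        moreover have "y (i + 1) = act (u [^] int i) (if i < b then p else x)"
          using i by (cases "i = b") (auto simp: y_def)
        moreover have "y (i - 1) = act (u [^] (int i - 2)) p" if "i \<noteq> 1"
          using that i by (auto simp: y_def of_nat_diff)
        moreover have "y (i - 1) = act (u [^] (int i - 1)) x" if "i = 1"
          using that by (simp add: y_def)
        ultimately show ?thesis using gprod_int_pow[OF u, of "int i - 1"] by simp
      qed
      ultimately show "gprod (y i) (y (i - 1)) (y (i + 1)) \<le> 5 * \<delta>"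
        by (simp split: if_splits)
    next
      fix i assume i: "i < b + 1"
      have "dist p (act (u [^] (1::int)) x) = dist x p" using p by (simp add: pow[symmetric])
      moreover have "dist p (act (u [^] (1::int)) p) = dist p (act u p)" by (simp add: pow)
      moreover have "dist (y i) (y (i + 1)) = (if i = 0 then dist x p else
          dist p (act (u [^] (1::int)) (if i < b then p else x)))"
      proof (cases "i = 0")
        case True
        then show ?thesis using \<open>1 \<le> b\<close> by (simp add: y_def)
      next
        case False
        then have "y i = act (u [^] (int i - 1)) p" using i by (simp add: y_def)
        moreover have "y (i + 1) = act (u [^] int i) (if i < b then p else x)"
          using i by (cases "i = b") (auto simp: y_def)
        ultimately show ?thesis using False dist_int_pow[OF u, of "int i - 1"] by simp
      qed
      ultimately show "2 * (5 * \<delta>) + 3 * \<delta> < dist (y i) (y (i + 1))"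
        using T \<tau> r delta_nonneg by simp
    qed (use assms delta_nonneg in auto)
    then show ?thesis by simp
  qed
qed

lemma axis_step:
  assumes "axis_point u x p" shows "1 + 100 * \<delta> \<le> dist p (act u p)"
  by (rule axis_chain(2)[OF assms, of 1 0 0 0]) auto

lemma axis_between:
  assumes ax: "axis_point u x p"
  shows "dist p (act (u [^] int i) p) + dist p (act (u [^] int j) p) - 14 * \<delta> \<le> dist p (act (u [^] int (i + j)) p)"
    and "dist x p + dist p (act (u [^] int k) p) - 14 * \<delta> \<le> dist x (act (u [^] int k) p)"
    and "dist x p + dist p (act (u [^] int k) p) - 14 * \<delta> \<le> dist p (act (u [^] int (k + 1)) x)"
    and "2 * dist x p + dist p (act (u [^] int k) p) - 28 * \<delta> \<le> dist x (act (u [^] int (k + 1)) x)"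
    and "k < b \<Longrightarrow> gprod (act (u [^] int k) p) x (act (u [^] int b) x) \<le> 7 * \<delta>"
proof -
  have u: "u \<in> carrier G" and p: "dist p (act u x) = dist x p"
    using ax by (auto simp: axis_point_def)
  note ch = axis_chain(1)[OF ax]
  show "dist p (act (u [^] int i) p) + dist p (act (u [^] int j) p) - 14 * \<delta> \<le> dist p (act (u [^] int (i + j)) p)"
    using ch[of "i + j + 1" 1 "i + 1" "i + j + 1"] dist_int_pow[OF u, of "int i" p "int (i + j)" p]
    by (simp add: gprod_def dist_commute)
  show 2: "dist x p + dist p (act (u [^] int k) p) - 14 * \<delta> \<le> dist x (act (u [^] int k) p)" for k
    using ch[of "k + 1" 0 1 "k + 1"] by (simp add: gprod_def dist_commute)
  have e: "dist (act (u [^] int k) p) (act (u [^] int (k + 1)) x) = dist x p" for k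
    using dist_int_pow[OF u, of "int k" p "int (k + 1)" x] p u by (simp add: int_pow_1)
  show "dist x p + dist p (act (u [^] int k) p) - 14 * \<delta> \<le> dist p (act (u [^] int (k + 1)) x)"
    using ch[of "k + 1" 1 "k + 1" "k + 2"] e[of k] by (simp add: gprod_def dist_commute)
  show "2 * dist x p + dist p (act (u [^] int k) p) - 28 * \<delta> \<le> dist x (act (u [^] int (k + 1)) x)"
    using ch[of "k + 1" 0 "k + 1" "k + 2"] e[of k] 2[of k] by (simp add: gprod_def dist_commute)
  show "k < b \<Longrightarrow> gprod (act (u [^] int k) p) x (act (u [^] int b) x) \<le> 7 * \<delta>"
    using ch[of b 0 "k + 1" "b + 1"] by simp
qed

lemma axis_mono:
  assumes ax: "axis_point u x p"
  shows "real k \<le> dist p (act (u [^] int k) p)"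
    and "k \<le> l \<Longrightarrow> dist p (act (u [^] int k) p) \<le> dist p (act (u [^] int l) p)"
proof -
  have u: "u \<in> carrier G" using ax by (auto simp: axis_point_def)
  have step: "dist p (act (u [^] int k) p) + 1 \<le> dist p (act (u [^] int (Suc k)) p)" for k
    using axis_between(1)[OF ax, of k 1] axis_step[OF ax] u delta_nonneg by (simp add: int_pow_1)
  show "real k \<le> dist p (act (u [^] int k) p)"
  proof (induction k)
    case (Suc k)
    then show ?case using step[of k] by simp
  qed simp
  show "k \<le> l \<Longrightarrow> dist p (act (u [^] int k) p) \<le> dist p (act (u [^] int l) p)"
  proof (rule lift_Suc_mono_le[of "\<lambda>k. dist p (act (u [^] int k) p)"])
    show "dist p (act (u [^] int k) p) \<le> dist p (act (u [^] int (Suc k)) p)" for k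
      using step[of k] by linarith
  qed
qed


subsection \<open>Elements reversing a quasi-axis\<close>

text \<open>If the geodesic from \<open>x\<close> along the axis of \<open>u\<close>, moved by \<open>v\<close>, follows the opposite end of the
  axis for long, then \<open>v\<close> reverses a long piece of the axis, and the elements
  \<open>inv v \<otimes> u [^] i \<otimes> v \<otimes> u [^] i\<close> almost fix it. Acylindricity makes two of them equal.\<close>

lemma reversal_near:
  assumes ax: "axis_point u x p" and v: "v \<in> carrier G" and e: "dist x (act v x) \<le> e"
    and ab: "M + 1 \<le> a" "M + 1 \<le> b" and k: "k \<le> M"
    and J: "dist x p + dist p (act (u [^] int M) p) + e
      \<le> gprod x (act (u [^] (- int a)) x) (act v (act (u [^] int b) x))"
  shows "dist (act v (act (u [^] int k) p)) (act (u [^] (- int (k + 1))) p) \<le> 32 * \<delta> + 3 * e"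
proof -
  have u: "u \<in> carrier G" and p: "dist p (act u x) = dist x p"
    using ax by (auto simp: axis_point_def)
  have e0: "0 \<le> e" using e by (rule order_trans[OF zero_le_dist])
  define P where "P = act v (act (u [^] int k) p)"
  \<comment> \<open>The shift by one is there because \<open>p\<close> lies between \<open>x\<close>
    and \<open>act u x\<close>: seen from \<open>x\<close>, the first axis point on the negative
    side is the translate of \<open>p\<close> by \<open>inv u\<close>.\<close>
  define w where "w = act (u [^] (- int (k + 1))) p"
  define z where "z = act (u [^] (- int a)) x"
  have "gprod P (act v x) (act v (act (u [^] int b) x)) \<le> 7 * \<delta>"
    using axis_between(5)[OF ax, of k b] k ab v by (simp add: P_def)
  then have 1: "gprod P x (act v (act (u [^] int b) x)) \<le> 7 * \<delta> + e"
    using gprod_lipschitz[of P x "act v (act (u [^] int b) x)" "act v x"] e by simp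
  have vP: "dist (act v x) P = dist x (act (u [^] int k) p)" using v by (simp add: P_def)
  have "dist x (act (u [^] int k) p) \<le> dist x p + dist p (act (u [^] int k) p)"
    by (rule dist_triangle)
  then have xP: "dist x P \<le> dist x p + dist p (act (u [^] int k) p) + e"
    using dist_triangle[of x P "act v x"] vP e by simp
  \<comment> \<open>By \<open>J\<close> the two rays from \<open>x\<close> stay together beyond
    \<open>P\<close>, so that \<open>P\<close> is almost between \<open>x\<close> and
    \<open>z\<close> as well.\<close>
  have "dist x P \<le> gprod x (act v (act (u [^] int b) x)) z"
    using xP J axis_mono(2)[OF ax k] by (simp add: z_def gprod_commute)
  then have 2: "gprod P x z \<le> 8 * \<delta> + e"
    using between_transfer[OF 1, of z] delta_nonneg e zero_le_dist[of x "act v x"] by simp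
  have "int (a - k - 1) = int a - int k - 1" using k ab by simp
  then have "gprod w x z = gprod (act (u [^] int (a - k - 1)) p) x (act (u [^] int a) x)"
    using gprod_int_pow[OF u, of "- int (k + 1)" p 0 x "- int a" x]
      gprod_int_pow[OF u, of "int (a - k - 1)" p 0 x "int a" x]
    by (simp add: w_def z_def gprod_commute algebra_simps)
  then have 3: "gprod w x z \<le> 8 * \<delta> + e"
    using axis_between(5)[OF ax, of "a - k - 1" a] k ab delta_nonneg e0 by simp
  have xw: "dist x w = dist p (act (u [^] int (k + 1)) x)"
    using dist_int_pow[OF u, of "- int (k + 1)" p 0 x] by (simp add: w_def dist_commute add.commute)
  have "dist (act (u [^] int k) p) (act (u [^] int (k + 1)) x) = dist x p"
    using dist_int_pow[OF u, of "int k" p "int (k + 1)" x] p u by (simp add: int_pow_1)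
  then have "dist x w \<le> dist x p + dist p (act (u [^] int k) p)"
    using xw dist_triangle[of p "act (u [^] int (k + 1)) x" "act (u [^] int k) p"] by simp
  moreover have "dist x p + dist p (act (u [^] int k) p) - 14 * \<delta> \<le> dist x w"
    using axis_between(3)[OF ax] xw by simp
  moreover have "dist x p + dist p (act (u [^] int k) p) - 14 * \<delta> - e \<le> dist x P"
    using axis_between(2)[OF ax, of k] vP e dist_triangle[of "act v x" P x] by (simp add: dist_commute)
  ultimately have "\<bar>dist x P - dist x w\<bar> \<le> 14 * \<delta> + e"
    using xP delta_nonneg e zero_le_dist[of x "act v x"] by simp
  then show ?thesis
    using dist_le_of_between[OF 2 3] by (simp add: P_def w_def)
qed

text \<open>The order of quantifiers is the point: \<open>N\<close> and \<open>M\<close> depend on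
  \<open>e\<close>, but not on \<open>u\<close>, \<open>v\<close> or the points. Equality of two of
  the almost fixing elements cancels to the relation with \<open>n = j - i\<close>.\<close>

lemma reversal:
  assumes "0 \<le> e"
  obtains N M :: nat where
    "\<And>u x p v a b. axis_point u x p \<Longrightarrow> v \<in> carrier G \<Longrightarrow> dist x (act v x) \<le> e \<Longrightarrow>
      M + 1 \<le> a \<Longrightarrow> M + 1 \<le> b \<Longrightarrow>
      dist x p + dist p (act (u [^] int M) p) + e
        \<le> gprod x (act (u [^] (- int a)) x) (act v (act (u [^] int b) x)) \<Longrightarrow>
      \<exists>n\<in>{1..N}. u [^] n \<otimes> v \<otimes> u [^] n = v"
proof -
  define \<epsilon> where "\<epsilon> = 64 * \<delta> + 6 * e + 1"
  have "0 < \<epsilon>" using assms delta_nonneg by (simp add: \<epsilon>_def)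
  then obtain R :: real and N :: nat where RN: "0 < R" "0 < N"
    "\<And>p q (\<gamma> :: nat \<Rightarrow> 'g). R \<le> dist p q \<Longrightarrow>
      (\<And>i. i \<le> N \<Longrightarrow> \<gamma> i \<in> carrier G \<and> dist p (act (\<gamma> i) p) \<le> \<epsilon> \<and> dist q (act (\<gamma> i) q) \<le> \<epsilon>) \<Longrightarrow>
      \<exists>i j. i < j \<and> j \<le> N \<and> \<gamma> i = \<gamma> j"
    using acylindrical_pigeonhole by blast
  define s where "s = nat \<lceil>R\<rceil>"
  have s: "R \<le> real s" by (simp add: s_def real_nat_ceiling_ge)
  show ?thesis
  \<comment> \<open>\<open>M = s + N\<close>: the points up to exponent \<open>s\<close> are
    watched, and the estimate for \<open>\<gamma> i\<close> involves points up to
    \<open>i \<le> N\<close> further along.\<close>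
  proof (rule that[of "s + N" N])
    fix u x p v a b
    assume ax: "axis_point u x p" and v: "v \<in> carrier G" and e: "dist x (act v x) \<le> e"
      and ab: "s + N + 1 \<le> a" "s + N + 1 \<le> b"
      and J: "dist x p + dist p (act (u [^] int (s + N)) p) + e
        \<le> gprod x (act (u [^] (- int a)) x) (act v (act (u [^] int b) x))"
    have u: "u \<in> carrier G" using ax by (auto simp: axis_point_def)
    define \<gamma> where "\<gamma> i = inv v \<otimes> (u [^] int i \<otimes> v \<otimes> u [^] int i)" for i :: nat
    have near: "dist (act (u [^] int k) p) (act (\<gamma> i) (act (u [^] int k) p)) \<le> \<epsilon>"
      if "k \<le> s" "i \<le> N" for k i
    proof -
      have 1: "act v (act (\<gamma> i) (act (u [^] int k) p)) = act (u [^] int i) (act v (act (u [^] int (k + i)) p))"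
        using u v by (simp add: \<gamma>_def act_mult act_int_pow_add add.commute)
      have "dist (act (u [^] int k) p) (act (\<gamma> i) (act (u [^] int k) p))
          = dist (act v (act (u [^] int k) p)) (act (u [^] int i) (act v (act (u [^] int (k + i)) p)))"
        using 1 v u dist_act[OF v, of "act (u [^] int k) p" "act (\<gamma> i) (act (u [^] int k) p)"]
        by simp
      also have "\<dots> \<le> dist (act v (act (u [^] int k) p)) (act (u [^] (- int (k + 1))) p)
          + dist (act (u [^] (- int (k + 1))) p) (act (u [^] int i) (act v (act (u [^] int (k + i)) p)))"
        by (rule dist_triangle)
      also have "dist (act (u [^] (- int (k + 1))) p) (act (u [^] int i) (act v (act (u [^] int (k + i)) p)))
          = dist (act v (act (u [^] int (k + i)) p)) (act (u [^] (- int (k + i + 1))) p)"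
        using dist_int_pow[OF u, of "int i" "act v (act (u [^] int (k + i)) p)" "- int (k + 1)" p]
        by (simp add: dist_commute algebra_simps)
      finally show ?thesis
        using reversal_near[OF ax v e ab, of k] reversal_near[OF ax v e ab, of "k + i"] that J
        by (simp add: \<epsilon>_def)
    qed
    have "R \<le> dist p (act (u [^] int s) p)"
      using axis_mono(1)[OF ax, of s] s by simp
    then obtain i j where ij: "i < j" "j \<le> N" "\<gamma> i = \<gamma> j"
      using RN(3)[of p "act (u [^] int s) p" \<gamma>] near[of 0] near[of s] u v by (auto simp: \<gamma>_def)
    define n where "n = j - i"
    have n: "n \<in> {1..N}" "j = n + i" using ij by (auto simp: n_def)
    have "u [^] i \<otimes> v \<otimes> u [^] i = u [^] j \<otimes> v \<otimes> u [^] j"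
      using ij(3) u v by (simp add: \<gamma>_def int_pow_int)
    also have "\<dots> = u [^] i \<otimes> (u [^] n \<otimes> v \<otimes> u [^] n) \<otimes> u [^] i"
    proof -
      have "u [^] j = u [^] i \<otimes> u [^] n" "u [^] j = u [^] n \<otimes> u [^] i"
        using u by (simp_all add: n nat_pow_mult add.commute)
      then show ?thesis using u v by (metis m_assoc m_closed nat_pow_closed)
    qed
    finally have "u [^] n \<otimes> v \<otimes> u [^] n = v" using u v by simp
    then show "\<exists>n\<in>{1..N}. u [^] n \<otimes> v \<otimes> u [^] n = v" using n by blast
  qed
qed

section \<open>Words alternating long axis translations with short moves\<close>

text \<open>Needed twice in the choice of exponents, with the roles of the two group elements
  exchanged. \<open>u\<close>, \<open>v1\<close>, \<open>v2\<close> and the points are quantified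
  inside, so one \<open>k0\<close> serves all of them.\<close>

definition forces_translation :: "real \<Rightarrow> nat \<Rightarrow> real \<Rightarrow> nat \<Rightarrow> bool" where
  "forces_translation e N t k0 \<longleftrightarrow> (\<forall>u x p v1 v2 k1 k2. axis_point u x p \<longrightarrow> v1 \<in> carrier G \<longrightarrow>
      v2 \<in> carrier G \<longrightarrow> dist x (act v1 x) \<le> e \<longrightarrow> dist x (act v2 x) \<le> e \<longrightarrow> k0 \<le> k1 \<longrightarrow> k0 \<le> k2 \<longrightarrow>
      (\<forall>n\<in>{1..N}. u [^] n \<otimes> v1 \<otimes> u [^] n \<noteq> v1 \<and> u [^] n \<otimes> v2 \<otimes> u [^] n \<noteq> v2) \<longrightarrow>
      translates (act (v1 \<otimes> u [^] k1 \<otimes> v2 \<otimes> u [^] k2)) t \<and>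
      dist x (act u x) + t \<le> dist x (act (v1 \<otimes> u [^] (k1::nat) \<otimes> v2 \<otimes> u [^] (k2::nat)) x))"

lemma forces_translationD:
  assumes "forces_translation e N t k0" "axis_point u x p" "v1 \<in> carrier G" "v2 \<in> carrier G"
    "dist x (act v1 x) \<le> e" "dist x (act v2 x) \<le> e" "k0 \<le> k1" "k0 \<le> k2"
    "\<And>n. n \<in> {1..N} \<Longrightarrow> u [^] n \<otimes> v1 \<otimes> u [^] n \<noteq> v1"
    "\<And>n. n \<in> {1..N} \<Longrightarrow> u [^] n \<otimes> v2 \<otimes> u [^] n \<noteq> v2"
  shows "translates (act (v1 \<otimes> u [^] k1 \<otimes> v2 \<otimes> u [^] k2)) t"
    and "dist x (act u x) + t \<le> dist x (act (v1 \<otimes> u [^] (k1::nat) \<otimes> v2 \<otimes> u [^] (k2::nat)) x)"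
  using assms unfolding forces_translation_def by blast+

text \<open>The orbit of \<open>x\<close> under the word, with the point reached after half a word
  inserted, is a broken line. A large product at a vertex would give, by \<open>reversal\<close>,
  one of the excluded relations; hence turns are small and \<open>gprod_chain\<close>
  applies.\<close>

lemma axis_word:
  assumes "0 \<le> e"
  obtains N :: nat where "\<And>t. \<exists>k0\<ge>1. forces_translation e N t k0"
proof (rule reversal[OF assms])
  fix M N :: nat
  assume rev: "\<And>u x p v a b. axis_point u x p \<Longrightarrow> v \<in> carrier G \<Longrightarrow>
      dist x (act v x) \<le> e \<Longrightarrow> M + 1 \<le> a \<Longrightarrow> M + 1 \<le> b \<Longrightarrow>
      dist x p + dist p (act (u [^] int M) p) + e
        \<le> gprod x (act (u [^] (- int a)) x) (act v (act (u [^] int b) x)) \<Longrightarrow>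
      \<exists>n\<in>{1..N}. u [^] n \<otimes> v \<otimes> u [^] n = v"
  show ?thesis
  proof (rule that)
    fix t :: real
    define g where "g = \<bar>t\<bar> + e + 1"
    \<comment> \<open>For \<open>long\<close>: a side has length at least
      \<open>2 * dist x p + 2 * TM + real q - 56 * \<delta> - e\<close> and must reach
      \<open>2 * c + 4 * \<delta> + g\<close>. The terms \<open>dist x p\<close> and
      \<open>TM\<close> cancel, which keeps \<open>k0\<close> independent of \<open>u\<close>,
      \<open>x\<close> and \<open>p\<close>.\<close>
    define q where "q = nat \<lceil>g + 5 * e + 60 * \<delta>\<rceil>"
    have q: "g + 5 * e + 60 * \<delta> \<le> real q" by (simp add: q_def real_nat_ceiling_ge)
    have g0: "0 < g" using assms by (simp add: g_def)
    define k0 where "k0 = 2 * M + q + 1"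
    show "\<exists>k0\<ge>1. forces_translation e N t k0"
      unfolding forces_translation_def
    proof (rule exI[of _ k0], intro conjI allI impI)
      show "1 \<le> k0" by (simp add: k0_def)
      fix u x p v1 v2 and k1 k2 :: nat
      assume ax: "axis_point u x p" and v: "v1 \<in> carrier G" "v2 \<in> carrier G"
        and e: "dist x (act v1 x) \<le> e" "dist x (act v2 x) \<le> e" and k: "k0 \<le> k1" "k0 \<le> k2"
        and exc: "\<forall>n\<in>{1..N}. u [^] n \<otimes> v1 \<otimes> u [^] n \<noteq> v1 \<and> u [^] n \<otimes> v2 \<otimes> u [^] n \<noteq> v2"
      have u: "u \<in> carrier G" using ax by (auto simp: axis_point_def)
      define f where "f = v1 \<otimes> u [^] k1 \<otimes> v2 \<otimes> u [^] k2"
      have f: "f \<in> carrier G" using u v by (simp add: f_def)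
      define TM where "TM = dist p (act (u [^] int M) p)"
      define c where "c = dist x p + TM + 2 * e"
      have c0: "0 \<le> c" using assms by (simp add: c_def TM_def)
      have long: "2 * c + 4 * \<delta> + g \<le> dist x (act v (act (u [^] int k) x))"
        if "v \<in> carrier G" "dist x (act v x) \<le> e" "k0 \<le> k" for v k
      proof -
        have "2 * dist x p + dist p (act (u [^] int (k - 1)) p) - 28 * \<delta> \<le> dist x (act (u [^] int k) x)"
          using axis_between(4)[OF ax, of "k - 1"] that(3) by (simp add: k0_def)
        moreover have "dist p (act (u [^] int (M + M + q)) p) \<le> dist p (act (u [^] int (k - 1)) p)"
          using that(3) by (intro axis_mono(2)[OF ax]) (simp add: k0_def)
        moreover have "2 * TM + real q - 28 * \<delta> \<le> dist p (act (u [^] int (M + M + q)) p)"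
          using axis_between(1)[OF ax, of "M + M" q] axis_between(1)[OF ax, of M M] axis_mono(1)[OF ax, of q]
          by (simp add: TM_def)
        moreover have "dist x (act (u [^] int k) x) \<le> dist x (act v (act (u [^] int k) x)) + e"
          using dist_triangle[of "act v x" "act v (act (u [^] int k) x)" x] that(1,2) u
          by (simp add: dist_commute)
        ultimately show ?thesis using q by (simp add: c_def)
      qed
      have turn: "gprod x (act (u [^] (- int a)) (act (inv v) x)) (act v' (act (u [^] int b) x)) \<le> c"
        if "v \<in> carrier G" "dist x (act v x) \<le> e" "v' \<in> carrier G" "dist x (act v' x) \<le> e"
          "k0 \<le> a" "k0 \<le> b" "\<forall>n\<in>{1..N}. u [^] n \<otimes> v' \<otimes> u [^] n \<noteq> v'" for v v' a b
      proof -
        have "dist (act (u [^] (- int a)) (act (inv v) x)) (act (u [^] (- int a)) x) \<le> e"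
          using that(1,2) u dist_act_inv[of v x x] by (simp add: dist_commute)
        moreover have "gprod x (act (u [^] (- int a)) x) (act v' (act (u [^] int b) x)) \<le> dist x p + TM + e"
          using rev[OF ax that(3,4), of a b] that(5-7) by (force simp: k0_def TM_def)
        ultimately show ?thesis
          using gprod_lipschitz[of x "act (u [^] (- int a)) (act (inv v) x)"
              "act v' (act (u [^] int b) x)" "act (u [^] (- int a)) x"]
          by (simp add: c_def)
      qed
      define y where "y i = act (f [^] (i div 2)) (if even i then x else act (v1 \<otimes> u [^] k1) x)" for i :: nat
      have ff: "act (f [^] Suc m) z = act (f [^] m) (act f z)" for m z
        using f by (simp add: act_mult)
      have f_x: "act f x = act (v1 \<otimes> u [^] k1) (act v2 (act (u [^] int k2) x))"
        using u v by (simp add: f_def act_mult int_pow_int)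
      have sides: "dist (y i) (y (i + 1)) = (if even i then dist x (act v1 (act (u [^] int k1) x))
          else dist x (act v2 (act (u [^] int k2) x)))" for i
      proof (cases "even i")
        case True
        then show ?thesis using f u v by (simp add: y_def act_mult int_pow_int)
      next
        case False
        then obtain m where m: "i = 2 * m + 1" by (elim oddE)
        have "y (i + 1) = act (f [^] m) (act f x)" using m by (simp add: y_def ff[symmetric] del: nat_pow_Suc)
        then show ?thesis using m f u v by (simp add: y_def f_x int_pow_int)
      qed
      have word_inv: "act (inv (v \<otimes> u [^] k)) z = act (u [^] (- int k)) (act (inv v) z)"
        if "v \<in> carrier G" for v z and k :: nat
        using that u by (simp add: inv_mult_group act_mult int_pow_neg int_pow_int)
      have turns: "gprod (y i) (y (i - 1)) (y (i + 1)) \<le> c" if "0 < i" for i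
      proof (cases "even i")
        case True
        define m where "m = i div 2 - 1"
        have m: "i = 2 * m + 2" using True that unfolding m_def by presburger
        have "gprod (y i) (y (i - 1)) (y (i + 1)) = gprod (act f x) (act (v1 \<otimes> u [^] k1) x) (act f (act (v1 \<otimes> u [^] k1) x))"
          using m f u v by (simp add: y_def act_mult)
        also have "\<dots> = gprod (act (v1 \<otimes> u [^] k1) (act (v2 \<otimes> u [^] k2) x)) (act (v1 \<otimes> u [^] k1) x)
            (act (v1 \<otimes> u [^] k1) (act (v2 \<otimes> u [^] k2) (act (v1 \<otimes> u [^] k1) x)))"
          using u v by (simp add: f_def act_mult)
        also have "\<dots> = gprod (act (v2 \<otimes> u [^] k2) x) (act (v2 \<otimes> u [^] k2) (act (inv (v2 \<otimes> u [^] k2)) x))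
            (act (v2 \<otimes> u [^] k2) (act (v1 \<otimes> u [^] k1) x))"
          using u v by simp
        also have "\<dots> = gprod x (act (inv (v2 \<otimes> u [^] k2)) x) (act (v1 \<otimes> u [^] k1) x)"
          by (rule gprod_act) (use u v in simp)
        also have "\<dots> \<le> c"
          using turn[OF v(2) e(2) v(1) e(1) k(2) k(1)] exc u v by (simp add: word_inv act_mult int_pow_int)
        finally show ?thesis .
      next
        case False
        then obtain m where m: "i = 2 * m + 1" by (elim oddE)
        have "y (i + 1) = act (f [^] m) (act f x)" using m by (simp add: y_def ff[symmetric] del: nat_pow_Suc)
        then have "gprod (y i) (y (i - 1)) (y (i + 1)) = gprod (act (v1 \<otimes> u [^] k1) x) x (act f x)"
          using m f u v by (simp add: y_def)
        also have "\<dots> = gprod (act (v1 \<otimes> u [^] k1) x) (act (v1 \<otimes> u [^] k1) (act (inv (v1 \<otimes> u [^] k1)) x))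
            (act (v1 \<otimes> u [^] k1) (act (v2 \<otimes> u [^] k2) x))"
          using u v by (simp add: f_def act_mult)
        also have "\<dots> = gprod x (act (inv (v1 \<otimes> u [^] k1)) x) (act (v2 \<otimes> u [^] k2) x)"
          by (rule gprod_act) (use u v in simp)
        also have "\<dots> \<le> c"
          using turn[OF v(1) e(1) v(2) e(2) k(1) k(2)] exc u v by (simp add: word_inv act_mult int_pow_int)
        finally show ?thesis .
      qed
      have side_long: "2 * c + 4 * \<delta> + g \<le> dist (y i) (y (i + 1))" for i
        using sides long[OF v(1) e(1) k(1)] long[OF v(2) e(2) k(2)] by simp
      have grow: "dist (y 0) (y i) + g \<le> dist (y 0) (y (i + 1))" for i
      proof -
        have "gprod (y i) (y 0) (y (i + 1)) \<le> c + 2 * \<delta>"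
        proof (rule gprod_chain[of "i + 1"])
          show "2 * c + 3 * \<delta> < dist (y j) (y (j + 1))" for j
            using side_long[of j] g0 delta_nonneg by simp
        qed (use turns c0 in auto)
        then show ?thesis using side_long[of i] by (simp add: gprod_def dist_commute)
      qed
      have "real n * t \<le> dist x (act (f [^] n) x)" for n
      proof -
        have "real i * g \<le> dist (y 0) (y i)" for i
        proof (induction i)
          case (Suc i)
          then show ?case using grow[of i] by (simp add: algebra_simps)
        qed simp
        from this[of "2 * n"] have "real (2 * n) * g \<le> dist x (act (f [^] n) x)" by (simp add: y_def)
        moreover have "real n * t \<le> real n * (2 * g)"
          using assms by (intro mult_left_mono) (auto simp: g_def)
        ultimately show ?thesis by simp
      qed
      then show "translates (act (v1 \<otimes> u [^] k1 \<otimes> v2 \<otimes> u [^] k2)) t"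
        using translatesI[OF f, of t 0 x] by (simp add: f_def)
      have "dist x (act u x) \<le> dist x (act (u [^] int k1) x)"
      proof -
        have "1 + (k1 - 1) = k1" using k by (simp add: k0_def)
        moreover have "dist x (act (u [^] (1::nat)) x) + real (k1 - 1) * (100 * \<delta> + 1)
            \<le> dist x (act (u [^] (1 + (k1 - 1))) x)"
          using ax delta_nonneg by (intro growing_pow_increment) (auto simp: axis_point_def)
        moreover have "0 \<le> real (k1 - 1) * (100 * \<delta> + 1)" using delta_nonneg by simp
        ultimately have "dist x (act (u [^] (1::nat)) x) \<le> dist x (act (u [^] k1) x)" by simp
        then show ?thesis using u by (simp add: int_pow_int)
      qed
      moreover have "dist x (act (u [^] int k1) x) \<le> dist x (act v1 (act (u [^] int k1) x)) + e"
        using dist_triangle[of "act v1 x" "act v1 (act (u [^] int k1) x)" x] v e u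
        by (simp add: dist_commute)
      moreover have "dist x (act v1 (act (u [^] int k1) x)) + g \<le> dist x (act f x)"
        using grow[of 1] u v f by (simp add: y_def act_mult int_pow_int)
      ultimately show "dist x (act u x) + t \<le> dist x (act (v1 \<otimes> u [^] k1 \<otimes> v2 \<otimes> u [^] k2) x)"
        by (simp add: f_def g_def)
    qed
  qed
qed


subsection \<open>Elements with unbounded orbits\<close>

definition unbounded_powers :: "'g \<Rightarrow> 's \<Rightarrow> bool" where
  "unbounded_powers g x \<longleftrightarrow> (\<forall>B. \<exists>l::nat. B < dist x (act (g [^] l) x))"

lemma growing_imp_unbounded:
  assumes "g \<in> carrier G" "growing C (act g) x" "0 < C"
  shows "unbounded_powers g x"
  unfolding unbounded_powers_def
proof
  fix B
  obtain l :: nat where "B < real l * C" using assms(3) reals_Archimedean3 by blast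
  then show "\<exists>l::nat. B < dist x (act (g [^] l) x)"
    using growing_pow_increment[OF assms, of 0 l] by (intro exI[of _ l]) simp
qed

lemma unbounded_powers_infinite_order:
  assumes "unbounded_powers g x" "g \<in> carrier G" "0 < (n::nat)"
  shows "g [^] n \<noteq> \<one>"
proof
  assume n: "g [^] n = \<one>"
  obtain l :: nat where l: "(\<Sum>i<n. dist x (act (g [^] i) x)) < dist x (act (g [^] l) x)"
    using assms(1) unfolding unbounded_powers_def by blast
  have "g [^] l = (g [^] n) [^] (l div n) \<otimes> g [^] (l mod n)"
    using assms(2) by (simp add: nat_pow_pow nat_pow_mult)
  then have "g [^] l = g [^] (l mod n)" using n assms(2) by simp
  moreover have "dist x (act (g [^] (l mod n)) x) \<le> (\<Sum>i<n. dist x (act (g [^] i) x))"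
    using assms(3) by (intro member_le_sum[of "l mod n" "{..<n}" "\<lambda>i. dist x (act (g [^] i) x)"]) auto
  ultimately show False using l by simp
qed

text \<open>The powers \<open>g [^] i\<close> commute with \<open>g [^] l\<close>, so an almost fixed point \<open>m\<close> of \<open>g [^] i\<close> near \<open>x\<close>
  has a translate near \<open>g [^] l\<close> applied to \<open>x\<close>; by convexity everything between is almost fixed,
  and acylindricity applies.\<close>

lemma unbounded_imp_growing:
  obtains J :: nat where "1 \<le> J"
    "\<And>g x. g \<in> carrier G \<Longrightarrow> unbounded_powers g x \<Longrightarrow> growing (100 * \<delta> + 1) (act (g [^] J)) x"
proof -
  define C where "C = 100 * \<delta> + 1"
  have C: "0 < C" "2 * \<delta> \<le> C" using delta_nonneg by (simp_all add: C_def)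
  \<comment> \<open>Almost fixed points are moved by at most \<open>C + 6 * \<delta>\<close>;
    convexity with error \<open>2 * \<delta>\<close> adds \<open>8 * \<delta>\<close>.\<close>
  define \<epsilon> where "\<epsilon> = C + 14 * \<delta>"
  have "0 < \<epsilon>" using C delta_nonneg by (simp add: \<epsilon>_def)
  then obtain R :: real and N :: nat where RN: "0 < R" "0 < N"
    "\<And>p q (\<gamma> :: nat \<Rightarrow> 'g). R \<le> dist p q \<Longrightarrow>
      (\<And>i. i \<le> N \<Longrightarrow> \<gamma> i \<in> carrier G \<and> dist p (act (\<gamma> i) p) \<le> \<epsilon> \<and> dist q (act (\<gamma> i) q) \<le> \<epsilon>) \<Longrightarrow>
      \<exists>i j. i < j \<and> j \<le> N \<and> \<gamma> i = \<gamma> j"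
    using acylindrical_pigeonhole by blast
  \<comment> \<open>For each \<open>g\<close> some exponent up to \<open>N + 1\<close> will work,
    but which one depends on \<open>g\<close>; the factorial is a common multiple.\<close>
  define J :: nat where "J = fact (N + 1)"
  have J: "1 \<le> J" unfolding J_def by (rule fact_ge_1)
  show ?thesis
  proof (rule that[OF J])
    fix g x assume g: "g \<in> carrier G" and unb: "unbounded_powers g x"
    have "\<exists>j\<in>{1..N + 1}. growing C (act (g [^] j)) x"
    proof (rule ccontr)
      assume neg: "\<not> ?thesis"
      define E where "E = (\<Sum>i\<in>{1..N + 1}. dist x (act (g [^] i) x))"
      have E: "dist x (act (g [^] i) x) \<le> E" if "i \<in> {1..N + 1}" for i
        unfolding E_def using that
        by (intro member_le_sum[of i "{1..N + 1}" "\<lambda>i. dist x (act (g [^] i) x)"]) auto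
      have E0: "0 \<le> E" unfolding E_def by (intro sum_nonneg) simp
      \<comment> \<open>Leaves a middle piece of length \<open>R\<close> between margins that keep
        it clear of the almost fixed points at both ends.\<close>
      obtain l :: nat where l: "2 * (E + 2 * \<delta> + 1) + R < dist x (act (g [^] l) x)"
        using unb unfolding unbounded_powers_def by blast
      define z where "z = act (g [^] l) x"
      have mid: "dist s (act (g [^] i) s) \<le> \<epsilon>"
        if i: "i \<in> {1..N + 1}" and s: "dist x s + dist s z = dist x z" "E + 2 * \<delta> + 1 \<le> dist x s"
          "E + 2 * \<delta> + 1 \<le> dist s z" for i s
      proof -
        have "\<not> growing C (act (g [^] i)) x" using neg i by blast
        then obtain m where m: "dist m (act (g [^] i) m) \<le> C + 6 * \<delta>" "dist x m = dist x (act (g [^] i) x) / 2"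
          using not_growing_almost_fixed[of "act (g [^] i)" C x] g C by auto
        have xm: "dist x m \<le> E" using m(2) E[OF i] zero_le_dist[of x "act (g [^] i) x"] by linarith
        define m' where "m' = act (g [^] l) m"
        have zm: "dist z m' \<le> E" using xm g by (simp add: z_def m'_def)
        have "gprod s x z \<le> 0" using s(1) by (simp add: gprod_def dist_commute)
        moreover have "0 + \<delta> < gprod s m x"
          using dist_triangle[of x s m] s(2) xm delta_nonneg by (simp add: gprod_def dist_commute)
        ultimately have 1: "gprod s m z \<le> \<delta>" using gprod_le_of_large2[of s x z 0 m] by simp
        have "\<delta> + \<delta> < gprod s m' z"
          using dist_triangle[of z s m'] s(3) zm delta_nonneg by (simp add: gprod_def dist_commute)
        then have 2: "gprod s m m' \<le> 2 * \<delta>" using gprod_le_of_large[OF 1, of m'] by simp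
        have "act (g [^] i) m' = act (g [^] l) (act (g [^] i) m)"
          using g by (simp add: m'_def act_mult[symmetric] nat_pow_mult add.commute)
        then have "dist m' (act (g [^] i) m') = dist m (act (g [^] i) m)"
          using g by (simp add: m'_def)
        then show ?thesis
          using displacement_convex[of "act (g [^] i)" s m m' "2 * \<delta>" "C + 6 * \<delta>"] g m(1) 2
          by (simp add: \<epsilon>_def)
      qed
      obtain p where p: "dist x p = E + 2 * \<delta> + 1" "dist p z = dist x z - (E + 2 * \<delta> + 1)"
        using interpolation[of "E + 2 * \<delta> + 1" x z] l RN(1) E0 delta_nonneg by (auto simp: z_def)
      obtain q where q: "dist x q = E + 2 * \<delta> + 1 + R" "dist q z = dist x z - (E + 2 * \<delta> + 1 + R)"
        using interpolation[of "E + 2 * \<delta> + 1 + R" x z] l RN(1) E0 delta_nonneg by (auto simp: z_def)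
      have "R \<le> dist p q" using p(1) q(1) dist_triangle[of x q p] by simp
      moreover have "dist p (act (g [^] Suc i) p) \<le> \<epsilon>" "dist q (act (g [^] Suc i) q) \<le> \<epsilon>" if "i \<le> N" for i
      proof -
        have i: "Suc i \<in> {1..N + 1}" using that by simp
        show "dist p (act (g [^] Suc i) p) \<le> \<epsilon>"
          using p l RN(1) by (intro mid[OF i]) (auto simp: z_def)
        show "dist q (act (g [^] Suc i) q) \<le> \<epsilon>"
          using q l RN(1) by (intro mid[OF i]) (auto simp: z_def)
      qed
      ultimately obtain i j where ij: "i < j" "j \<le> N" "g [^] Suc i = g [^] Suc j"
        using RN(3)[of p q "\<lambda>i. g [^] Suc i"] g by (metis nat_pow_closed)
      have "g [^] Suc j = g [^] (j - i) \<otimes> g [^] Suc i"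
        using nat_pow_mult[OF g, of "j - i" "Suc i"] ij(1) by (simp del: nat_pow_Suc)
      then have "g [^] (j - i) = \<one>"
        using ij(3) g by (metis nat_pow_closed r_cancel_one')
      then show False
        using unbounded_powers_infinite_order[OF unb g, of "j - i"] ij(1) by simp
    qed
    then obtain j where j: "j \<in> {1..N + 1}" "growing C (act (g [^] j)) x" by blast
    have "j dvd J" unfolding J_def using j(1) by (intro dvd_fact) auto
    then obtain i where i: "J = j * i" by blast
    then have "1 \<le> i" using J by (cases i) auto
    have u: "g [^] j \<in> carrier G" using g by simp
    have "growing C (act ((g [^] j) [^] i)) x"
    proof (cases "i = 1")
      case True
      then show ?thesis using j u by simp
    next
      case False
      then have "2 * C \<le> real i * C" using C \<open>1 \<le> i\<close> by (intro mult_right_mono) auto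
      then show ?thesis
        using growing_pow_increment[OF u j(2) C(1), of i i] C(2) u
        by (simp add: growing_def act_mult[symmetric] nat_pow_mult)
    qed
    then show "growing (100 * \<delta> + 1) (act (g [^] J)) x"
      using g i by (simp add: C_def nat_pow_pow)
  qed
qed

section \<open>Reversed translations and the choice of exponents\<close>

lemma growing_weaken: "growing C f x \<Longrightarrow> C' \<le> C \<Longrightarrow> growing C' f x"
  by (simp add: growing_def)

lemma reversed_pow:
  assumes "w \<in> carrier G" "v \<in> carrier G" "w \<otimes> v \<otimes> w = v"
  shows "w [^] (j::nat) \<otimes> v \<otimes> w [^] j = v"
proof (induction j)
  case (Suc j)
  have "w [^] Suc j \<otimes> v \<otimes> w [^] Suc j = w [^] j \<otimes> (w \<otimes> v \<otimes> w) \<otimes> w [^] j"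
    using assms(1,2) nat_pow_Suc2[OF assms(1), of j] by (metis m_assoc m_closed nat_pow_Suc nat_pow_closed)
  then show ?case using Suc assms by simp
qed (use assms in simp)

text \<open>If \<open>v\<close> reversed a large power \<open>y\<close> of \<open>u\<close>, then \<open>v \<otimes> y\<close> would have the same square as \<open>v\<close>
  although it moves \<open>x\<close> much further than \<open>v \<otimes> v\<close> does, so that \<open>v \<otimes> v\<close> would almost fix a midpoint.\<close>

lemma translation_not_reversing:
  assumes u: "u \<in> carrier G" and grow: "growing (100 * \<delta> + 1) (act u) x" and v: "v \<in> carrier G"
    and tr: "translates (act (v \<otimes> v)) s" "8 * \<delta> < s" and n: "1 \<le> n"
  shows "u [^] (n::nat) \<otimes> v \<otimes> u [^] n \<noteq> v"
proof
  assume "u [^] n \<otimes> v \<otimes> u [^] n = v"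
  then have rev: "(u [^] n) [^] (j::nat) \<otimes> v \<otimes> (u [^] n) [^] j = v" for j
    using u v by (intro reversed_pow[of "u [^] n" v j]) auto
  obtain j :: nat where j: "dist x (act v x) + dist x (act (v \<otimes> v) x) < real j"
    using reals_Archimedean2 by blast
  define y where "y = (u [^] n) [^] j"
  have y: "y \<in> carrier G" using u by (simp add: y_def)
  define f where "f = v \<otimes> y"
  have f: "f \<in> carrier G" using v y by (simp add: f_def)
  have ff: "f \<otimes> f = v \<otimes> v"
    using rev[of j] v y by (simp add: f_def y_def[symmetric] m_assoc)
  have "real j \<le> real (n * j) * 1" using n by (cases n) auto
  also have "\<dots> \<le> real (n * j) * (100 * \<delta> + 1)"
    using delta_nonneg by (intro mult_left_mono) auto
  also have "\<dots> \<le> dist x (act y x)"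
    using growing_pow_increment[OF u grow, of 0 "n * j"] delta_nonneg u by (simp add: y_def nat_pow_pow)
  also have "\<dots> \<le> dist x (act v x) + dist x (act f x)"
    using dist_triangle[of "act v x" "act f x" x] v y by (simp add: f_def act_mult dist_commute)
  finally have far: "dist x (act f (act f x)) \<le> dist x (act f x)"
    using j f ff by (simp add: act_mult[symmetric])
  obtain m where "dist x m = dist x (act f x) / 2" "dist m (act f x) = dist x (act f x) / 2"
    using midpoint_exists by blast
  then have "dist m (act f m) \<le> 4 * \<delta>"
    using midpoint_displacement[of "act f" x m] f far by simp
  moreover have "dist (act f m) (act f (act f m)) = dist m (act f m)" using f by simp
  ultimately have "dist m (act f (act f m)) \<le> 8 * \<delta>"
    using dist_triangle[of m "act f (act f m)" "act f m"] by simp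
  moreover have "s \<le> dist m (act f (act f m))"
    using translates_displacement[OF _ tr(1), of m] v f ff by (simp add: act_mult[symmetric])
  ultimately show False using tr(2) by simp
qed

lemma translates_conj:
  assumes "f \<in> carrier G" "h \<in> carrier G" "y \<in> carrier G" "y \<otimes> h = f \<otimes> y" "translates (act f) t"
  shows "translates (act h) t"
proof -
  fix x
  obtain D where D: "\<And>n::nat. real n * t - D \<le> dist (act y x) (act (f [^] n) (act y x))"
    using translatesD[OF assms(1,5), of "act y x"] by blast
  have "y \<otimes> h [^] n = f [^] n \<otimes> y" for n :: nat
  proof (induction n)
    case (Suc n)
    have "y \<otimes> h [^] Suc n = f [^] n \<otimes> (y \<otimes> h)"
      using Suc assms(1-3) by (simp add: m_assoc[symmetric])
    then show ?case using assms by (simp add: m_assoc)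
  qed (use assms in simp)
  then have "act y (act (h [^] n) x) = act (f [^] n) (act y x)" for n :: nat
    using assms by (simp add: act_mult[symmetric])
  then have "real n * t - D \<le> dist x (act (h [^] n) x)" for n :: nat
    using D[of n] assms(2,3) dist_act[of y x "act (h [^] n) x"] by simp
  then show ?thesis using assms(2) by (rule translatesI[rotated])
qed

text \<open>The relation reduces the word to \<open>H \<otimes> (y \<otimes> y)\<close> and makes
  \<open>H\<close> commute with \<open>y \<otimes> y\<close>. Powers then split, and each factor
  \<open>y \<otimes> y\<close> moves \<open>m\<close> by at most \<open>2 * C\<close>.\<close>

lemma reversing_word_translates:
  assumes H: "H \<in> carrier G" and y: "y \<in> carrier G" and rev: "H \<otimes> y \<otimes> H = y"
    and tr: "translates (act H) t" and C: "dist m (act y m) \<le> C"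
  shows "translates (act (H \<otimes> H \<otimes> y \<otimes> H \<otimes> y)) (t - 2 * C)"
proof -
  have "H \<otimes> H \<otimes> y \<otimes> H \<otimes> y = H \<otimes> (H \<otimes> y \<otimes> H) \<otimes> y"
    using H y by (simp add: m_assoc)
  then have V: "H \<otimes> H \<otimes> y \<otimes> H \<otimes> y = H \<otimes> (y \<otimes> y)" using H y rev by (simp add: m_assoc)
  have comm: "H \<otimes> (y \<otimes> y) = (y \<otimes> y) \<otimes> H"
  proof -
    have "H \<otimes> (y \<otimes> y) = H \<otimes> y \<otimes> (H \<otimes> y \<otimes> H)" using H y rev by (simp add: m_assoc)
    also have "\<dots> = (H \<otimes> y \<otimes> H) \<otimes> y \<otimes> H" using H y by (simp add: m_assoc)
    finally show ?thesis using rev by simp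
  qed
  have yy: "dist m (act ((y \<otimes> y) [^] n) m) \<le> real n * (2 * C)" for n :: nat
  proof (induction n)
    case (Suc n)
    have "dist m (act (y \<otimes> y) m) \<le> 2 * C"
      using dist_triangle[of m "act y (act y m)" "act y m"] C y by (simp add: act_mult)
    then have "dist (act ((y \<otimes> y) [^] n) m) (act ((y \<otimes> y) [^] Suc n) m) \<le> 2 * C"
      using y by (simp add: act_mult)
    then show ?case
      using Suc dist_triangle[of m "act ((y \<otimes> y) [^] Suc n) m" "act ((y \<otimes> y) [^] n) m"]
      by (simp add: algebra_simps)
  qed simp
  obtain D where D: "\<And>n::nat. real n * t - D \<le> dist m (act (H [^] n) m)"
    using translatesD[OF H tr, of m] by blast
  have "real n * (t - 2 * C) - D \<le> dist m (act ((H \<otimes> (y \<otimes> y)) [^] n) m)" for n :: nat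
  proof -
    have "(H \<otimes> (y \<otimes> y)) [^] n = H [^] n \<otimes> (y \<otimes> y) [^] n"
      using comm H y by (intro pow_mult_distrib) auto
    then have "dist (act (H [^] n) m) (act ((H \<otimes> (y \<otimes> y)) [^] n) m) \<le> real n * (2 * C)"
      using yy[of n] H y by (simp add: act_mult)
    then show ?thesis
      using D[of n] dist_triangle[of m "act (H [^] n) m" "act ((H \<otimes> (y \<otimes> y)) [^] n) m"]
      by (simp add: algebra_simps dist_commute)
  qed
  then show ?thesis unfolding V using H y by (intro translatesI) auto
qed


text \<open>With \<open>h\<close> a large power of \<open>\<eta>\<close> and \<open>y\<close> a large power of \<open>g\<close>: if \<open>g\<close> has bounded powers, then in
  \<open>forces_translation\<close> the element \<open>u\<close> is \<open>h\<close>, both \<open>v\<close> are \<open>y\<close> and the base point is almost fixed by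
  \<open>y\<close>; otherwise \<open>u\<close> is a power of \<open>g\<close> and the \<open>v\<close> are powers of \<open>h\<close>.\<close>

lemma growing_word:
  assumes \<eta>: "\<eta> \<in> carrier G" "unbounded_powers \<eta> x"
  obtains p q k :: nat where "1 \<le> k"
    "\<And>g. g \<in> carrier G \<Longrightarrow> growing (100 * \<delta> + 1) (act (\<eta> [^] p \<otimes> g [^] k \<otimes> \<eta> [^] q \<otimes> g [^] k)) x"
    "\<And>g. g \<in> carrier G \<Longrightarrow> growing (100 * \<delta> + 1) (act g) x \<Longrightarrow>
      dist x (act g x) + 1 \<le> dist x (act (\<eta> [^] p \<otimes> g [^] k \<otimes> \<eta> [^] q \<otimes> g [^] k) x)"
proof -
  define C where "C = 100 * \<delta> + 1"
  \<comment> \<open>\<open>C' = C + 6 * \<delta>\<close> is both the translation that guarantees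
    \<open>growing C\<close> and the displacement of the almost fixed point of an element that is
    not growing.\<close>
  define C' where "C' = 106 * \<delta> + 1"
  have C: "0 < C" using delta_nonneg by (simp add: C_def)
  obtain J :: nat where J: "1 \<le> J"
    "\<And>g x. g \<in> carrier G \<Longrightarrow> unbounded_powers g x \<Longrightarrow> growing (100 * \<delta> + 1) (act (g [^] J)) x"
    using unbounded_imp_growing by blast
  \<comment> \<open>The factor 2 makes \<open>h\<close> translate by \<open>2 * C\<close>, enough
    for it to be growing with constant \<open>100 * \<delta> + 1\<close> at every base point, also
    at one that depends on \<open>g\<close>.\<close>
  define h where "h = \<eta> [^] (2 * J)"
  have h: "h \<in> carrier G" using \<eta> by (simp add: h_def)
  have tr_h: "translates (act (h [^] b)) (2 * real b * C)" for b :: nat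
  proof (rule translatesI[of _ _ 0 x])
    have "growing C (act (\<eta> [^] J)) x" using J(2) \<eta> by (simp add: C_def)
    then show "real n * (2 * real b * C) - 0 \<le> dist x (act ((h [^] b) [^] n) x)" for n
      using growing_pow_increment[of "\<eta> [^] J" C x 0 "2 * b * n"] \<eta> C
      by (simp add: h_def nat_pow_pow algebra_simps)
  qed (use h in simp)
  have "0 \<le> C'" using delta_nonneg by (simp add: C'_def)
  then obtain N k0 where k0: "1 \<le> k0" "forces_translation C' N C' k0"
    using axis_word by metis
  \<comment> \<open>The factor \<open>k0\<close> makes the exponent long enough,
    \<open>fact N\<close> makes it a multiple of every possible reversing exponent, and 4 lets the
    translation of \<open>h [^] b\<close> outweigh the loss \<open>2 * C'\<close>.\<close>
  define b :: nat where "b = 4 * k0 * fact N"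
  have "(4 * k0) * 1 \<le> b" unfolding b_def by (intro mult_le_mono order_refl fact_ge_1)
  then have b: "k0 \<le> b" "4 \<le> b" using k0(1) by auto
  \<comment> \<open>\<open>k\<close> can be chosen after \<open>b\<close>, from the displacements of
    the powers of \<open>h\<close>, because the case of bounded powers puts no condition on
    \<open>k\<close>.\<close>
  define e where "e = max (dist x (act (h [^] (2 * b)) x)) (dist x (act (h [^] b) x))"
  have "0 \<le> e" by (simp add: e_def le_max_iff_disj)
  then obtain N' k where k1: "1 \<le> k" and k: "forces_translation e N' C' k"
    using axis_word by metis
  have pow_h: "\<eta> [^] (2 * J * (2 * b)) = h [^] (2 * b)" "\<eta> [^] (2 * J * b) = h [^] b"
    using \<eta> by (simp_all add: h_def nat_pow_pow)
  have growingI: "growing C (act V) x" if "V \<in> carrier G" "translates (act V) C'" for V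
    using translates_growing[of "act V" C' x] that delta_nonneg by (simp add: C_def C'_def)
  have unb: "growing C (act (h [^] (2 * b) \<otimes> g [^] (J * k) \<otimes> h [^] b \<otimes> g [^] (J * k))) x \<and>
      dist x (act (g [^] J) x) + 1 \<le> dist x (act (h [^] (2 * b) \<otimes> g [^] (J * k) \<otimes> h [^] b \<otimes> g [^] (J * k)) x)"
    if g: "g \<in> carrier G" "unbounded_powers g x" for g
  proof -
    define u where "u = g [^] J"
    have u: "u \<in> carrier G" "growing (100 * \<delta> + 1) (act u) x" using g J(2) by (simp_all add: u_def)
    obtain p where ax: "axis_point u x p" using axis_point_exists u by blast
    have "u [^] n \<otimes> h [^] c \<otimes> u [^] n \<noteq> h [^] c" if "n \<in> {1..N'}" "4 \<le> c" for n c :: nat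
    proof (rule translation_not_reversing[OF u])
      show "translates (act (h [^] c \<otimes> h [^] c)) (2 * real (c + c) * C)"
        using tr_h[of "c + c"] h by (simp add: nat_pow_mult)
      have "8 * \<delta> < 16 * C" using delta_nonneg by (simp add: C_def)
      also have "\<dots> \<le> 2 * real (c + c) * C" using that C by (intro mult_right_mono) auto
      finally show "8 * \<delta> < 2 * real (c + c) * C" .
    qed (use h that in auto)
    then have "translates (act (h [^] (2 * b) \<otimes> u [^] k \<otimes> h [^] b \<otimes> u [^] k)) C'"
      "dist x (act u x) + C' \<le> dist x (act (h [^] (2 * b) \<otimes> u [^] k \<otimes> h [^] b \<otimes> u [^] k) x)"
      using forces_translationD[OF k ax, of "h [^] (2 * b)" "h [^] b" k k] b h by (simp_all add: e_def)
    then show ?thesis using growingI g h delta_nonneg by (simp add: u_def nat_pow_pow C'_def)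
  qed
  have bdd: "growing C (act (h [^] (2 * b) \<otimes> g [^] (J * k) \<otimes> h [^] b \<otimes> g [^] (J * k))) x"
    if g: "g \<in> carrier G" "\<not> unbounded_powers g x" for g
  proof -
    define y where "y = g [^] (J * k)"
    have y: "y \<in> carrier G" using g by (simp add: y_def)
    have "\<not> growing C (act y) x"
    proof
      assume "growing C (act y) x"
      then have "unbounded_powers y x" using growing_imp_unbounded y C by blast
      then have "unbounded_powers g x"
        using g unfolding unbounded_powers_def y_def nat_pow_pow[OF g(1)] by blast
      then show False using g by simp
    qed
    then obtain m where m: "dist m (act y m) \<le> C'"
      using not_growing_almost_fixed[of "act y" C x] y C by (auto simp: C_def C'_def)
    define V where "V = h [^] (2 * b) \<otimes> y \<otimes> h [^] b \<otimes> y"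
    have V: "V \<in> carrier G" using h y by (simp add: V_def)
    have "growing C (act V) x"
    proof (cases "\<exists>n\<in>{1..N}. h [^] n \<otimes> y \<otimes> h [^] n = y")
      case True
      then obtain n where n: "n \<in> {1..N}" "h [^] n \<otimes> y \<otimes> h [^] n = y" by blast
      then have "n dvd fact N" by (intro dvd_fact) auto
      then obtain c where "b = n * c" unfolding b_def by (metis dvd_mult dvd_def)
      then have "h [^] b \<otimes> y \<otimes> h [^] b = y"
        using reversed_pow[of "h [^] n" y c] h y n by (simp add: nat_pow_pow)
      moreover have "h [^] (2 * b) = h [^] b \<otimes> h [^] b" using h by (simp add: nat_pow_mult mult_2)
      ultimately have "translates (act V) (2 * real b * C - 2 * C')"
        using reversing_word_translates[of "h [^] b" y _ m] tr_h h y m by (simp add: V_def)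
      moreover have "8 * C \<le> 2 * real b * C" using b C by (intro mult_right_mono) auto
      ultimately show ?thesis
        using translates_growing[of "act V" "2 * real b * C - 2 * C'" x] V delta_nonneg
        by (auto simp: C_def C'_def intro: growing_weaken)
    next
      case False
      have "growing (2 * C - 6 * \<delta>) (act h) m"
        using translates_growing[of "act h" "2 * C" m] tr_h[of 1] h delta_nonneg by (simp add: C_def)
      then have "growing (100 * \<delta> + 1) (act h) m"
        using delta_nonneg by (elim growing_weaken) (simp add: C_def)
      then obtain p where ax: "axis_point h m p" using axis_point_exists h by blast
      have "translates (act (y \<otimes> h [^] (2 * b) \<otimes> y \<otimes> h [^] b)) C'"
        using forces_translationD(1)[OF k0(2) ax y y m m] False b by simp
      then have "translates (act V) C'"
        \<comment> \<open>Cyclic rotation: \<open>y\<close> is moved from the front of the word to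
          its end.\<close>
        by (intro translates_conj[of "y \<otimes> h [^] (2 * b) \<otimes> y \<otimes> h [^] b" V y])
          (use h y V in \<open>auto simp: V_def m_assoc\<close>)
      then show ?thesis using growingI V by blast
    qed
    then show ?thesis by (simp add: V_def y_def)
  qed
  show ?thesis
  proof (rule that[of "J * k" "2 * J * (2 * b)" "2 * J * b"], unfold pow_h)
    show "1 \<le> J * k" using J(1) k1 by (metis mult_le_mono nat_mult_1)
    fix g assume g: "g \<in> carrier G"
    show "growing (100 * \<delta> + 1) (act (h [^] (2 * b) \<otimes> g [^] (J * k) \<otimes> h [^] b \<otimes> g [^] (J * k))) x"
      using unb[OF g] bdd[OF g] unfolding C_def by blast
    assume grow: "growing (100 * \<delta> + 1) (act g) x"
    then have "unbounded_powers g x" using growing_imp_unbounded[OF g] C by (simp add: C_def)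
    moreover have "dist x (act g x) \<le> dist x (act (g [^] J) x)"
    proof -
      have "0 \<le> real (J - 1) * C" using C by simp
      moreover have "dist x (act (g [^] (1::nat)) x) + real (J - 1) * C \<le> dist x (act (g [^] (1 + (J - 1))) x)"
        using grow C g unfolding C_def by (intro growing_pow_increment) auto
      ultimately have "dist x (act (g [^] (1::nat)) x) \<le> dist x (act (g [^] (1 + (J - 1))) x)" by linarith
      then show ?thesis using J(1) g by simp
    qed
    ultimately show "dist x (act g x) + 1 \<le> dist x (act (h [^] (2 * b) \<otimes> g [^] (J * k) \<otimes> h [^] b \<otimes> g [^] (J * k)) x)"
      using unb[OF g] by linarith
  qed
qed

end


section \<open>Nested infinite words\<close>

text \<open>Position \<open>(is, q)\<close> of the \<open>n\<close>-th word: descend into the copies number \<open>is ! 0\<close>, \<open>is ! 1\<close>, \dots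
  of the words number \<open>n + 1\<close>, \<open>n + 2\<close>, \dots and take the letter \<open>q\<close> of the coefficient word in
  front of the last copy.\<close>

fun nested_pos :: "(nat \<Rightarrow> nat) \<Rightarrow> (nat \<Rightarrow> nat \<Rightarrow> nat iword) \<Rightarrow> nat \<Rightarrow> nat list \<Rightarrow> nat \<Rightarrow> bool" where
  "nested_pos r w n [] q \<longleftrightarrow> False"
| "nested_pos r w n (i # is) q \<longleftrightarrow>
     i < r n \<and> (if is = [] then q \<in> wdom (w n i) else nested_pos r w (Suc n) is q)"

fun nested_lab :: "(nat \<Rightarrow> nat \<Rightarrow> nat iword) \<Rightarrow> nat \<Rightarrow> nat list \<Rightarrow> nat \<Rightarrow> letter" where
  "nested_lab w n [] q = (1, True)"
| "nested_lab w n (i # is) q = (if is = [] then wlab (w n i) q else nested_lab w (Suc n) is q)"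

text \<open>Lexicographic on addresses, a prefix before its extensions: the coefficient
  \<open>[i]\<close> stands before everything inside copy \<open>i\<close>. Letters of one
  coefficient follow its own order.\<close>

fun nested_le :: "(nat \<Rightarrow> nat \<Rightarrow> nat iword) \<Rightarrow> nat \<Rightarrow> nat list \<Rightarrow> nat \<Rightarrow> nat list \<Rightarrow> nat \<Rightarrow> bool" where
  "nested_le w n [] q js q' \<longleftrightarrow> False"
| "nested_le w n (i # is) q [] q' \<longleftrightarrow> False"
| "nested_le w n (i # is) q (j # js) q' \<longleftrightarrow> i < j \<or> i = j \<and>
     (if is = [] then js \<noteq> [] \<or> (q, q') \<in> wle (w n i) else nested_le w (Suc n) is q js q')"

definition nested_word :: "(nat \<Rightarrow> nat) \<Rightarrow> (nat \<Rightarrow> nat \<Rightarrow> nat iword) \<Rightarrow> nat \<Rightarrow> (nat list \<times> nat) iword" where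
  "nested_word r w n = \<lparr> wdom = {(is, q). nested_pos r w n is q},
     wle = {((is, q), (js, q')). nested_pos r w n is q \<and> nested_pos r w n js q' \<and> nested_le w n is q js q'},
     wlab = (\<lambda>(is, q). nested_lab w n is q) \<rparr>"

lemma nested_le_Nil [simp]: "\<not> nested_le w n is q [] q'"
  by (cases "is") auto

text \<open>\<open>tail\<close> makes substitution of unbounded depth legitimate: a letter of index
  \<open>k\<close> occurs only in coefficients of levels below \<open>k\<close>, and each level
  contributes finitely many of them.\<close>

locale nested =
  fixes r :: "nat \<Rightarrow> nat" and w :: "nat \<Rightarrow> nat \<Rightarrow> nat iword"
  assumes words: "is_word (w n i)"
    and tail: "wlab (w n i) ` wdom (w n i) \<inter> letters_upto n = {}"
begin

lemma linear: "linear_order_on (wdom (w n i)) (wle (w n i))"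
  using words by (simp add: is_word_def)

lemma nested_le_refl: "nested_pos r w n is q \<Longrightarrow> nested_le w n is q is q"
proof (induction "is" arbitrary: n)
  case (Cons i "is")
  then show ?case using linear[of n i] by (auto simp: order_on_defs refl_on_def split: if_splits)
qed simp

lemma nested_le_antisym:
  "nested_le w n is q js q' \<Longrightarrow> nested_le w n js q' is q \<Longrightarrow> is = js \<and> q = q'"
proof (induction "is" arbitrary: n js)
  case (Cons i "is")
  then obtain j ks where js: "js = j # ks" by (cases js) auto
  show ?case
  proof (cases "is = []")
    case True
    then show ?thesis
      using Cons.prems js linear[of n i] by (auto simp: order_on_defs dest: antisymD split: if_splits)
  next
    case False
    then show ?thesis using Cons.prems js Cons.IH[of "Suc n" ks] by (auto split: if_splits)
  qed
qed simp

lemma nested_le_trans: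
  "nested_le w n is q js q' \<Longrightarrow> nested_le w n js q' ks q'' \<Longrightarrow> nested_le w n is q ks q''"
proof (induction "is" arbitrary: n js ks)
  case (Cons i "is")
  then obtain j js' where js: "js = j # js'" by (cases js) auto
  with Cons.prems obtain k ks' where ks: "ks = k # ks'" by (cases ks) auto
  show ?case
  proof (cases "i = j \<and> j = k")
    case False
    then show ?thesis using Cons.prems js ks by auto
  next
    case True
    show ?thesis
    proof (cases "is = []")
      case True
      with \<open>i = j \<and> j = k\<close> show ?thesis
        using Cons.prems js ks linear[of n i]
        by (cases "js' = []"; cases "ks' = []") (auto simp: order_on_defs dest: transD)
    next
      case False
      with \<open>i = j \<and> j = k\<close> show ?thesis
        using Cons.prems js ks Cons.IH[of "Suc n" js' ks'] by (auto split: if_splits)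
    qed
  qed
qed simp

lemma nested_le_total:
  "nested_pos r w n is q \<Longrightarrow> nested_pos r w n js q' \<Longrightarrow> nested_le w n is q js q' \<or> nested_le w n js q' is q"
proof (induction "is" arbitrary: n js)
  case (Cons i "is")
  then obtain j ks where js: "js = j # ks" by (cases js) auto
  consider "i \<noteq> j" | "i = j" "is = []" "ks = []" | "i = j" "is = []" "ks \<noteq> []"
    | "i = j" "is \<noteq> []" "ks = []" | "i = j" "is \<noteq> []" "ks \<noteq> []" by blast
  then show ?case
  proof cases
    case 2
    then show ?thesis
      using Cons.prems js linear[of n i]
      by (cases "q = q'") (auto simp: order_on_defs total_on_def refl_on_def)
  next
    case 5
    then show ?thesis using Cons.prems js Cons.IH[of "Suc n" ks] by auto
  qed (use js in auto)
qed simp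

lemma nested_lab_large:
  "nested_pos r w n is q \<Longrightarrow> nested_lab w n is q \<in> letters \<and> n < fst (nested_lab w n is q)"
proof (induction "is" arbitrary: n)
  case (Cons i "is")
  show ?case
  proof (cases "is = []")
    case True
    then have q: "q \<in> wdom (w n i)" using Cons.prems by simp
    then have "wlab (w n i) q \<in> letters" "wlab (w n i) q \<notin> letters_upto n"
      using words[of n i] tail[of n i] by (auto simp: is_word_def)
    then show ?thesis using True
      by (cases "wlab (w n i) q") (auto simp: letters_def letters_upto_def)
  next
    case False
    then show ?thesis using Cons.prems Cons.IH[of "Suc n"] by auto
  qed
qed simp

lemma finite_nested_lab: "finite {(is, q). nested_pos r w n is q \<and> nested_lab w n is q = a}"
proof (induction "fst a - n" arbitrary: n)
  case 0
  then have "{(is, q). nested_pos r w n is q \<and> nested_lab w n is q = a} = {}"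
    using nested_lab_large by fastforce
  then show ?case by (simp only: finite.emptyI)
next
  case (Suc d)
  let ?S = "{(is, q). nested_pos r w (Suc n) is q \<and> nested_lab w (Suc n) is q = a}"
  have "finite ?S" using Suc by simp
  moreover have "finite {q \<in> wdom (w n i). wlab (w n i) q = a}" for i
    using words[of n i] by (simp add: is_word_def del: split_paired_All)
  ultimately have "finite (\<Union>i<r n. (\<lambda>q. ([i], q)) ` {q \<in> wdom (w n i). wlab (w n i) q = a} \<union>
      (\<lambda>(is, q). (i # is, q)) ` ?S)"
    by blast
  moreover have "{(is, q). nested_pos r w n is q \<and> nested_lab w n is q = a} \<subseteq>
    (\<Union>i<r n. (\<lambda>q. ([i], q)) ` {q \<in> wdom (w n i). wlab (w n i) q = a} \<union> (\<lambda>(is, q). (i # is, q)) ` ?S)"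
  proof
    fix p assume "p \<in> {(is, q). nested_pos r w n is q \<and> nested_lab w n is q = a}"
    then obtain "is" q where p: "p = (is, q)" "nested_pos r w n is q" "nested_lab w n is q = a" by auto
    then obtain i js where "is": "is = i # js" by (cases "is") auto
    show "p \<in> (\<Union>i<r n. (\<lambda>q. ([i], q)) ` {q \<in> wdom (w n i). wlab (w n i) q = a} \<union>
        (\<lambda>(is, q). (i # is, q)) ` ?S)"
      using p "is" by (cases "js = []") (force simp: image_iff)+
  qed
  ultimately show ?case by (rule rev_finite_subset)
qed

lemma is_word_nested: "is_word (nested_word r w n)"
proof -
  have "linear_order_on (wdom (nested_word r w n)) (wle (nested_word r w n))"
    unfolding order_on_defs
  proof (intro conjI)
    show "refl_on (wdom (nested_word r w n)) (wle (nested_word r w n))"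
      by (auto simp: nested_word_def refl_on_def nested_le_refl)
    show "trans (wle (nested_word r w n))"
      by (auto simp: nested_word_def intro!: transI intro: nested_le_trans)
    show "antisym (wle (nested_word r w n))"
      by (auto simp: nested_word_def intro!: antisymI dest: nested_le_antisym)
    show "total_on (wdom (nested_word r w n)) (wle (nested_word r w n))"
      using nested_le_total by (auto simp: nested_word_def total_on_def)
  qed (auto simp: nested_word_def)
  moreover have "{i \<in> wdom (nested_word r w n). wlab (nested_word r w n) i = a} =
      {(is, q). nested_pos r w n is q \<and> nested_lab w n is q = a}" for a
    by (auto simp: nested_word_def)
  ultimately show ?thesis
    using finite_nested_lab[of n] nested_lab_large[of n]
    by (auto simp: is_word_def nested_word_def simp del: split_paired_All)
qed

text \<open>The recursion holds for the lists themselves, before any cancellation. The positions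
  whose address begins with \<open>i\<close> form the block \<open>F i\<close>, and the blocks
  follow one another in the order of \<open>i\<close>.\<close>

lemma proj_nested_word:
  "proj_word N (nested_word r w n) =
    concat (map (\<lambda>i. proj_word N (w n i) @ proj_word N (nested_word r w (Suc n))) [0..<r n])"
proof -
  have "\<exists>xs. distinct xs \<and> set xs = positions N (w n i) \<and> sorted_wrt (\<lambda>p q. (p, q) \<in> wle (w n i)) xs \<and>
      proj_word N (w n i) = map (wlab (w n i)) xs" for i
    using proj_wordE[OF words, of N n i] by metis
  then obtain A where A: "\<And>i. distinct (A i)" "\<And>i. set (A i) = positions N (w n i)"
    "\<And>i. sorted_wrt (\<lambda>p q. (p, q) \<in> wle (w n i)) (A i)"
    "\<And>i. proj_word N (w n i) = map (wlab (w n i)) (A i)" by metis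
  let ?v = "nested_word r w (Suc n)" and ?u = "nested_word r w n"
  obtain B where B: "distinct B" "set B = positions N ?v" "sorted_wrt (\<lambda>p q. (p, q) \<in> wle ?v) B"
    "proj_word N ?v = map (wlab ?v) B" using proj_wordE[OF is_word_nested] by metis
  define F where "F i = map (Pair [i]) (A i) @ map (\<lambda>(is, q). (i # is, q)) B" for i
  have B_pos: "nested_pos r w (Suc n) is q" "is \<noteq> []" if "(is, q) \<in> set B" for "is" q
    using that B(2) by (auto simp: positions_def nested_word_def)
  have pos_Cons: "(i # is, q) \<in> positions N ?u \<longleftrightarrow>
      i < r n \<and> (if is = [] then q \<in> positions N (w n i) else (is, q) \<in> positions N ?v)" for i "is" q
    by (simp add: positions_def nested_word_def)
  have pos_Nil: "([], q) \<notin> positions N (nested_word r w k)" for q k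
    by (simp add: positions_def nested_word_def)
  have F_set: "set (F i) = {p \<in> positions N ?u. hd (fst p) = i}" if "i < r n" for i
  proof -
    have "(is, q) \<in> set (F i) \<longleftrightarrow> (is, q) \<in> positions N ?u \<and> hd is = i" for "is" q
    proof (cases "is")
      case Nil
      then show ?thesis using pos_Nil by (auto simp: F_def)
    next
      case (Cons j js)
      then show ?thesis
        using that pos_Nil by (cases "js = []") (auto simp: F_def pos_Cons A(2) B(2) image_iff split: prod.splits)
    qed
    then show ?thesis by auto
  qed
  have F_dist: "distinct (F i)" for i
    using A(1) B(1) B_pos(2) by (auto simp: F_def distinct_map inj_on_def)
  have F_sorted: "sorted_wrt (\<lambda>p q. (p, q) \<in> wle ?u) (F i)" if i: "i < r n" for i
  proof -
    have "sorted_wrt (\<lambda>p q. ((\<lambda>(is, q). (i # is, q)) p, (\<lambda>(is, q). (i # is, q)) q) \<in> wle ?u) B"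
      by (rule sorted_wrt_mono_rel[OF _ B(3)]) (use i B_pos in \<open>auto simp: nested_word_def\<close>)
    moreover have "sorted_wrt (\<lambda>p q. (([i], p), ([i], q)) \<in> wle ?u) (A i)"
      by (rule sorted_wrt_mono_rel[OF _ A(3)])
        (use i A(2) in \<open>auto simp: nested_word_def positions_def\<close>)
    ultimately show ?thesis
      using i A(2) B_pos
      by (auto simp: F_def sorted_wrt_append sorted_wrt_map nested_word_def positions_def)
  qed
  have "m \<le> r n \<Longrightarrow> distinct (concat (map F [0..<m])) \<and>
      set (concat (map F [0..<m])) = {p \<in> positions N ?u. hd (fst p) < m} \<and>
      sorted_wrt (\<lambda>p q. (p, q) \<in> wle ?u) (concat (map F [0..<m]))" for m
  proof (induction m)
    case (Suc m)
    then have IH: "distinct (concat (map F [0..<m]))"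
      "set (concat (map F [0..<m])) = {p \<in> positions N ?u. hd (fst p) < m}"
      "sorted_wrt (\<lambda>p q. (p, q) \<in> wle ?u) (concat (map F [0..<m]))" and m: "m < r n" by auto
    have split: "concat (map F [0..<Suc m]) = concat (map F [0..<m]) @ F m" by simp
    have cross: "(p, q) \<in> wle ?u" if "p \<in> positions N ?u" "q \<in> positions N ?u" "hd (fst p) < hd (fst q)" for p q
    proof -
      obtain "is" a js b where "p = (is, a)" "q = (js, b)" by (cases p, cases q)
      with that show ?thesis
        by (cases "is"; cases js) (auto simp: positions_def nested_word_def)
    qed
    show ?case
      unfolding split using IH F_set[OF m] F_dist[of m] F_sorted[OF m] cross
      by (auto simp: sorted_wrt_append simp del: set_concat)
  qed simp
  from this[of "r n"] have all: "distinct (concat (map F [0..<r n]))"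
    "set (concat (map F [0..<r n])) = {p \<in> positions N ?u. hd (fst p) < r n}"
    "sorted_wrt (\<lambda>p q. (p, q) \<in> wle ?u) (concat (map F [0..<r n]))" by auto
  have hd: "{p \<in> positions N ?u. hd (fst p) < r n} = positions N ?u"
  proof -
    have "hd is < r n" if "nested_pos r w n is q" for "is" q using that by (cases "is") auto
    then show ?thesis by (auto simp: positions_def nested_word_def)
  qed
  have "proj_word N ?u = map (wlab ?u) (concat (map F [0..<r n]))"
    by (rule proj_word_eq[OF is_word_nested all(1) all(2)[unfolded hd] all(3)])
  also have "\<dots> = concat (map (\<lambda>i. map (wlab ?u) (F i)) [0..<r n])"
    by (simp add: map_concat o_def)
  also have "\<dots> = concat (map (\<lambda>i. proj_word N (w n i) @ proj_word N ?v) [0..<r n])"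
  proof -
    have "map (wlab ?u) (F i) = proj_word N (w n i) @ proj_word N ?v" for i
      using A(4) B(4) B_pos(2) by (auto simp: F_def nested_word_def)
    then show ?thesis by simp
  qed
  finally show ?thesis .
qed

end


section \<open>Elements of the Hawaiian earring group and their projections\<close>

text \<open>Describes a class by one finite word for each \<open>N\<close>, up to cancellation. This
  determines the class, so identities in \<open>HEG\<close> can be checked on lists without building
  a word for each product.\<close>

definition represents :: "nat iword set \<Rightarrow> (nat \<Rightarrow> letter list) \<Rightarrow> bool" where
  "represents P f \<longleftrightarrow> (\<exists>w :: nat iword. is_word w \<and> P = word_class w \<and>
     (\<forall>N. (proj_word N w, f N) \<in> free_eq N \<and> set (f N) \<subseteq> letters_upto N))"

lemma represents_word_class:
  assumes "is_word w" shows "represents (word_class w) (\<lambda>N. proj_word N w)"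
proof -
  obtain v :: "nat iword" where v: "is_word v" "word_iso v w" using ex_nat_word_iso[OF assms] by blast
  then have "word_equiv v w" using assms by (intro word_iso_imp_equiv)
  moreover from this have "word_class w = word_class v" using word_class_eqI by metis
  ultimately show ?thesis
    using v(1) set_proj_word[OF assms] unfolding represents_def word_equiv_def by blast
qed

lemma represents_unique:
  assumes "represents P f" "represents Q f" shows "P = Q"
proof -
  obtain w :: "nat iword" where w: "P = word_class w" "\<And>N. (proj_word N w, f N) \<in> free_eq N"
    using assms(1) unfolding represents_def by blast
  obtain u :: "nat iword" where u: "Q = word_class u" "\<And>N. (proj_word N u, f N) \<in> free_eq N"
    using assms(2) unfolding represents_def by blast
  show ?thesis unfolding w(1) u(1)
    using free_eq_trans[OF w(2) free_eq_sym[OF u(2)]]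
    by (intro word_class_eqI) (auto simp: word_equiv_def)
qed

lemma represents_equiv:
  assumes "represents P f" "\<And>N. (f N, g N) \<in> free_eq N" "\<And>N. set (g N) \<subseteq> letters_upto N"
  shows "represents P g"
  using assms unfolding represents_def by (blast intro: free_eq_trans)

lemma represents_mult:
  assumes "represents P f" "represents Q g"
  shows "represents (P \<otimes>\<^bsub>HEG\<^esub> Q) (\<lambda>N. f N @ g N)"
proof -
  obtain w :: "nat iword" where w: "is_word w" "P = word_class w" "\<And>N. (proj_word N w, f N) \<in> free_eq N"
    "\<And>N. set (f N) \<subseteq> letters_upto N"
    using assms(1) unfolding represents_def by blast
  obtain u :: "nat iword" where u: "is_word u" "Q = word_class u" "\<And>N. (proj_word N u, g N) \<in> free_eq N"
    "\<And>N. set (g N) \<subseteq> letters_upto N"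
    using assms(2) unfolding represents_def by blast
  have "represents (P \<otimes>\<^bsub>HEG\<^esub> Q) (\<lambda>N. proj_word N (word_append w u))"
    unfolding w(2) u(2) HEG_mult[OF w(1) u(1)]
    by (intro represents_word_class is_word_append w u)
  moreover have "(proj_word N (word_append w u), f N @ g N) \<in> free_eq N" for N
    unfolding proj_word_append[OF w(1) u(1)]
    by (intro free_eq_append w(3,4) u(3) set_proj_word u(1))
  ultimately show ?thesis
    by (rule represents_equiv) (simp add: w(4) u(4))
qed

lemma represents_one: "represents \<one>\<^bsub>HEG\<^esub> (\<lambda>N. [])"
proof -
  define e :: "nat iword" where "e = \<lparr> wdom = {}, wle = {}, wlab = (\<lambda>_. (1, True)) \<rparr>"
  have e: "is_word e" by (simp add: is_word_def e_def)
  have "proj_word n e = []" for n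
    using proj_word_eq[OF e, of "[]" n] by (simp add: positions_def e_def)
  moreover have "\<one>\<^bsub>HEG\<^esub> = word_class e" by (simp add: HEG_def e_def)
  ultimately show ?thesis using represents_word_class[OF e] by simp
qed

lemma represents_prod:
  assumes "\<And>i. represents (P i) (f i)"
  shows "represents (foldr (\<lambda>i Q. P i \<otimes>\<^bsub>HEG\<^esub> Q) xs \<one>\<^bsub>HEG\<^esub>) (\<lambda>N. concat (map (\<lambda>i. f i N) xs))"
  by (induction xs) (auto intro: represents_one represents_mult assms)

section \<open>Tail subgroups and infinite systems of equations\<close>

lemma HEG_tailE:
  assumes "P \<in> HEG_tail n"
  obtains w :: "nat iword" where "is_word w" "P = word_class w" "wlab w ` wdom w \<inter> letters_upto n = {}"
proof -
  obtain w :: "nat iword" where w: "P \<in> carrier HEG" "w \<in> P" "wlab w ` wdom w \<inter> letters_upto n = {}"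
    using assms by (auto simp: HEG_tail_def)
  obtain v :: "nat iword" where v: "is_word v" "P = word_class v" using w(1) by (rule HEG_cases)
  have wv: "is_word w" "word_equiv w v" using w(2) unfolding v(2) word_class_def by blast+
  have "P = word_class w" unfolding v(2) by (rule word_class_eqI[OF wv(2), symmetric])
  then show ?thesis using that wv(1) w(3) by blast
qed

lemma HEG_tailI:
  fixes w :: "'x iword"
  assumes "is_word w" "wlab w ` wdom w \<inter> letters_upto n = {}"
  shows "word_class w \<in> HEG_tail n"
proof -
  obtain v :: "nat iword" where v: "is_word v" "word_iso v w" using ex_nat_word_iso[OF assms(1)] by blast
  then have "v \<in> word_class w" using assms(1) by (simp add: word_class_def word_iso_imp_equiv)
  moreover have "wlab v ` wdom v \<subseteq> wlab w ` wdom w"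
  proof -
    obtain f where "bij_betw f (wdom v) (wdom w)" "\<And>i. i \<in> wdom v \<Longrightarrow> wlab v i = wlab w (f i)"
      using v(2) unfolding word_iso_def by blast
    then show ?thesis using bij_betwE by fastforce
  qed
  ultimately show ?thesis
    using assms word_class_in_HEG unfolding HEG_tail_def by blast
qed

lemma subgroup_HEG_tail: "subgroup (HEG_tail n) HEG"
proof -
  interpret HEG: group HEG by (rule group_HEG)
  show ?thesis
  proof (rule HEG.subgroupI)
    show "HEG_tail n \<subseteq> carrier HEG" by (auto simp: HEG_tail_def)
    show "HEG_tail n \<noteq> {}"
      using HEG_tailI[of "\<lparr> wdom = {}, wle = {}, wlab = (\<lambda>_. (1, True)) \<rparr> :: nat iword" n]
      by (auto simp: is_word_def)
  next
    fix P assume "P \<in> HEG_tail n"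
    then obtain w :: "nat iword" where w: "is_word w" "P = word_class w" "wlab w ` wdom w \<inter> letters_upto n = {}"
      by (rule HEG_tailE)
    note iw = is_word_inverse[OF w(1)]
    have "represents (word_class (word_inverse w) \<otimes>\<^bsub>HEG\<^esub> P)
        (\<lambda>N. proj_word N (word_inverse w) @ proj_word N w)"
      unfolding w(2) by (intro represents_mult represents_word_class iw w)
    then have "represents (word_class (word_inverse w) \<otimes>\<^bsub>HEG\<^esub> P) (\<lambda>N. [])"
      by (rule represents_equiv) (simp_all add: proj_word_inverse[OF w(1)] free_eq_inverse set_proj_word[OF w(1)])
    then have "word_class (word_inverse w) \<otimes>\<^bsub>HEG\<^esub> P = \<one>\<^bsub>HEG\<^esub>"
      using represents_one by (rule represents_unique)
    then have "inv\<^bsub>HEG\<^esub> P = word_class (word_inverse w)"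
      using w iw by (intro HEG.inv_equality) (auto intro: word_class_in_HEG)
    moreover have "word_class (word_inverse w) \<in> HEG_tail n"
      using w(3) by (intro HEG_tailI iw) (auto simp: word_inverse_def)
    ultimately show "inv\<^bsub>HEG\<^esub> P \<in> HEG_tail n" by simp
    fix Q assume "Q \<in> HEG_tail n"
    then obtain u :: "nat iword" where u: "is_word u" "Q = word_class u" "wlab u ` wdom u \<inter> letters_upto n = {}"
      by (rule HEG_tailE)
    have "word_class (word_append w u) \<in> HEG_tail n"
      using w(3) u(3) by (intro HEG_tailI is_word_append w u) (auto simp: word_append_def)
    then show "P \<otimes>\<^bsub>HEG\<^esub> Q \<in> HEG_tail n" by (simp add: w u HEG_mult)
  qed
qed

text \<open>The nested words provide the solution: by \<open>proj_nested_word\<close> both sides of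
  the equation are represented by the same lists.\<close>

lemma HEG_nested_product:
  assumes "\<And>n i. \<alpha> n i \<in> HEG_tail n"
  obtains x :: "nat \<Rightarrow> nat iword set" where "\<And>n. x n \<in> carrier HEG"
    "\<And>n. x n = foldr (\<lambda>i Q. (\<alpha> n i \<otimes>\<^bsub>HEG\<^esub> x (Suc n)) \<otimes>\<^bsub>HEG\<^esub> Q) [0..<r n] \<one>\<^bsub>HEG\<^esub>"
proof -
  have "\<exists>w :: nat iword. is_word w \<and> \<alpha> n i = word_class w \<and> wlab w ` wdom w \<inter> letters_upto n = {}" for n i
    using HEG_tailE[OF assms] by metis
  then obtain w :: "nat \<Rightarrow> nat \<Rightarrow> nat iword" where w: "\<And>n i. is_word (w n i)" "\<And>n i. \<alpha> n i = word_class (w n i)"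
    "\<And>n i. wlab (w n i) ` wdom (w n i) \<inter> letters_upto n = {}" by metis
  interpret nested r w by unfold_locales (use w in auto)
  show ?thesis
  proof (rule that[of "\<lambda>n. word_class (nested_word r w n)"])
    fix n
    show "word_class (nested_word r w n) \<in> carrier HEG" by (intro word_class_in_HEG is_word_nested)
    have "represents (foldr (\<lambda>i Q. (\<alpha> n i \<otimes>\<^bsub>HEG\<^esub> word_class (nested_word r w (Suc n))) \<otimes>\<^bsub>HEG\<^esub> Q) [0..<r n] \<one>\<^bsub>HEG\<^esub>)
        (\<lambda>N. concat (map (\<lambda>i. proj_word N (w n i) @ proj_word N (nested_word r w (Suc n))) [0..<r n]))"
      unfolding w(2) by (intro represents_prod represents_mult represents_word_class is_word_nested w(1))
    then show "word_class (nested_word r w n) =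
        foldr (\<lambda>i Q. (\<alpha> n i \<otimes>\<^bsub>HEG\<^esub> word_class (nested_word r w (Suc n))) \<otimes>\<^bsub>HEG\<^esub> Q) [0..<r n] \<one>\<^bsub>HEG\<^esub>"
      using represents_word_class[OF is_word_nested, of n]
      unfolding proj_nested_word[of _ n] by (rule represents_unique[rotated])
  qed
qed

lemma HEG_nested_equations:
  assumes a: "\<And>n. a n \<in> HEG_tail n" and b: "\<And>n. b n \<in> HEG_tail n" and k: "\<And>n. 1 \<le> (k n :: nat)"
  shows "\<exists>x. \<forall>n. x n \<in> carrier HEG \<and>
    x n = a n \<otimes>\<^bsub>HEG\<^esub> x (Suc n) [^]\<^bsub>HEG\<^esub> k n \<otimes>\<^bsub>HEG\<^esub> b n \<otimes>\<^bsub>HEG\<^esub> x (Suc n) [^]\<^bsub>HEG\<^esub> k n"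
proof -
  interpret HEG: group HEG by (rule group_HEG)
  \<comment> \<open>Of the \<open>2 * k n\<close> coefficients only those in front of the two blocks
    of \<open>k n\<close> copies are nontrivial; \<open>k n \<ge> 1\<close> keeps the two places
    apart.\<close>
  define \<alpha> where "\<alpha> n i = (if i = 0 then a n else if i = k n then b n else \<one>\<^bsub>HEG\<^esub>)" for n i
  have "\<alpha> n i \<in> HEG_tail n" for n i
    using a b subgroup.one_closed[OF subgroup_HEG_tail] by (simp add: \<alpha>_def)
  then obtain x :: "nat \<Rightarrow> nat iword set" where x: "\<And>n. x n \<in> carrier HEG"
    "\<And>n. x n = foldr (\<lambda>i Q. (\<alpha> n i \<otimes>\<^bsub>HEG\<^esub> x (Suc n)) \<otimes>\<^bsub>HEG\<^esub> Q) [0..<2 * k n] \<one>\<^bsub>HEG\<^esub>"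
    using HEG_nested_product[of \<alpha> "\<lambda>n. 2 * k n"] by metis
  have ab: "a n \<in> carrier HEG" "b n \<in> carrier HEG" for n using a b by (auto simp: HEG_tail_def)
  show ?thesis
  proof (rule exI[of _ x], intro allI conjI)
    fix n
    let ?f = "foldr (\<lambda>i Q. (\<alpha> n i \<otimes>\<^bsub>HEG\<^esub> x (Suc n)) \<otimes>\<^bsub>HEG\<^esub> Q)"
    have pow: "?f xs c = x (Suc n) [^]\<^bsub>HEG\<^esub> length xs \<otimes>\<^bsub>HEG\<^esub> c"
      if "\<And>i. i \<in> set xs \<Longrightarrow> i \<noteq> 0 \<and> i \<noteq> k n" "c \<in> carrier HEG" for xs c
      using that(1)
    proof (induction xs)
      case (Cons i xs)
      have "i \<noteq> 0 \<and> i \<noteq> k n" using Cons.prems by simp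
      then have "\<alpha> n i = \<one>\<^bsub>HEG\<^esub>" by (simp add: \<alpha>_def)
      then show ?case
        using Cons that(2) x(1)[of "Suc n"] HEG.nat_pow_Suc2[OF x(1)[of "Suc n"], of "length xs"]
        by (simp add: HEG.m_assoc del: HEG.nat_pow_Suc nat_pow_Suc)
    qed (use that(2) in simp)
    obtain m where m: "k n = Suc m" using k[of n] by (cases "k n") auto
    have "[0..<2 * k n] = 0 # [1..<k n] @ k n # [Suc (k n)..<2 * k n]"
      using upt_add_eq_append[of 0 "k n" "k n"] m by (simp add: upt_conv_Cons mult_2 del: upt_Suc)
    then have "x n = (\<alpha> n 0 \<otimes>\<^bsub>HEG\<^esub> x (Suc n)) \<otimes>\<^bsub>HEG\<^esub> ?f [1..<k n]
        ((\<alpha> n (k n) \<otimes>\<^bsub>HEG\<^esub> x (Suc n)) \<otimes>\<^bsub>HEG\<^esub> ?f [Suc (k n)..<2 * k n] \<one>\<^bsub>HEG\<^esub>)"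
      using x(2)[of n] by (simp only: foldr.simps foldr_append o_apply)
    also have "?f [Suc (k n)..<2 * k n] \<one>\<^bsub>HEG\<^esub> = x (Suc n) [^]\<^bsub>HEG\<^esub> m"
    proof -
      have "?f [Suc (k n)..<2 * k n] \<one>\<^bsub>HEG\<^esub> =
          x (Suc n) [^]\<^bsub>HEG\<^esub> length [Suc (k n)..<2 * k n] \<otimes>\<^bsub>HEG\<^esub> \<one>\<^bsub>HEG\<^esub>"
        by (rule pow) auto
      also have "length [Suc (k n)..<2 * k n] = m" using m by (simp del: upt_Suc)
      finally show ?thesis using x(1) by simp
    qed
    also have "?f [1..<k n] ((\<alpha> n (k n) \<otimes>\<^bsub>HEG\<^esub> x (Suc n)) \<otimes>\<^bsub>HEG\<^esub> x (Suc n) [^]\<^bsub>HEG\<^esub> m)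
        = x (Suc n) [^]\<^bsub>HEG\<^esub> m \<otimes>\<^bsub>HEG\<^esub> ((b n \<otimes>\<^bsub>HEG\<^esub> x (Suc n)) \<otimes>\<^bsub>HEG\<^esub> x (Suc n) [^]\<^bsub>HEG\<^esub> m)"
    proof -
      have "?f [1..<k n] ((\<alpha> n (k n) \<otimes>\<^bsub>HEG\<^esub> x (Suc n)) \<otimes>\<^bsub>HEG\<^esub> x (Suc n) [^]\<^bsub>HEG\<^esub> m)
          = x (Suc n) [^]\<^bsub>HEG\<^esub> length [1..<k n] \<otimes>\<^bsub>HEG\<^esub>
            ((\<alpha> n (k n) \<otimes>\<^bsub>HEG\<^esub> x (Suc n)) \<otimes>\<^bsub>HEG\<^esub> x (Suc n) [^]\<^bsub>HEG\<^esub> m)"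
        using x(1) ab by (intro pow) (auto simp: \<alpha>_def)
      moreover have "length [1..<k n] = m" using m by (simp del: upt_Suc)
      moreover have "\<alpha> n (k n) = b n" using m by (simp add: \<alpha>_def)
      ultimately show ?thesis by simp
    qed
    also have "\<alpha> n 0 = a n" by (simp add: \<alpha>_def)
    also have "(a n \<otimes>\<^bsub>HEG\<^esub> x (Suc n)) \<otimes>\<^bsub>HEG\<^esub> (x (Suc n) [^]\<^bsub>HEG\<^esub> m \<otimes>\<^bsub>HEG\<^esub>
        ((b n \<otimes>\<^bsub>HEG\<^esub> x (Suc n)) \<otimes>\<^bsub>HEG\<^esub> x (Suc n) [^]\<^bsub>HEG\<^esub> m)) = a n \<otimes>\<^bsub>HEG\<^esub> x (Suc n) [^]\<^bsub>HEG\<^esub> k n \<otimes>\<^bsub>HEG\<^esub> b n \<otimes>\<^bsub>HEG\<^esub> x (Suc n) [^]\<^bsub>HEG\<^esub> k n"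
    proof -
      have "x (Suc n) [^]\<^bsub>HEG\<^esub> k n = x (Suc n) \<otimes>\<^bsub>HEG\<^esub> x (Suc n) [^]\<^bsub>HEG\<^esub> m"
        unfolding m by (rule HEG.nat_pow_Suc2[OF x(1)])
      then show ?thesis using x(1) ab by (simp only: HEG.m_assoc HEG.m_closed HEG.nat_pow_closed)
    qed
    finally show "x n = a n \<otimes>\<^bsub>HEG\<^esub> x (Suc n) [^]\<^bsub>HEG\<^esub> k n \<otimes>\<^bsub>HEG\<^esub> b n \<otimes>\<^bsub>HEG\<^esub> x (Suc n) [^]\<^bsub>HEG\<^esub> k n" .
  qed (rule x(1))
qed

section \<open>Homomorphisms from the Hawaiian earring group\<close>

text \<open>One bounded orbit suffices for \<open>elliptic\<close>, so its failure concerns every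
  \<open>x\<close>; negative powers move \<open>x\<close> exactly as far as positive ones.\<close>

lemma (in acylindrical_space) not_elliptic_unbounded:
  assumes g: "g \<in> carrier G" and "\<not> elliptic G act g"
  shows "unbounded_powers g x"
proof (rule ccontr)
  assume "\<not> ?thesis"
  then obtain B where B: "\<And>l::nat. dist x (act (g [^] l) x) \<le> B"
    unfolding unbounded_powers_def by (meson not_less)
  have "dist x (act (g [^] (k::int)) x) \<le> B" for k
  proof (cases k)
    case (nonneg n)
    then show ?thesis using B[of n] by (simp add: int_pow_int)
  next
    case (neg n)
    then have "dist x (act (g [^] k) x) = dist (act (g [^] Suc n) x) x"
      using dist_act_inv[of "g [^] Suc n" x x] g by (simp add: int_pow_neg int_pow_int del: nat_pow_Suc of_nat_Suc)
    then show ?thesis using B[of "Suc n"] by (simp add: dist_commute)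
  qed
  then have "bounded (orbit (G\<lparr>carrier := generate G {g}\<rparr>) act x)"
    unfolding bounded_any_center[of _ x]
    by (intro exI[of _ B]) (auto simp: orbit_def generate_pow[OF g])
  then show False using assms(2) unfolding elliptic_def by blast
qed

text \<open>Bridges an index shift: the claim asks for \<open>n \<ge> 1\<close>, while the equations
  start at level 0, so \<open>h n\<close> is first found in \<open>HEG_tail (Suc n)\<close>.\<close>

lemma HEG_tail_Suc_subset: "HEG_tail (Suc n) \<subseteq> HEG_tail n"
proof -
  have "letters_upto n \<subseteq> letters_upto (Suc n)" by (auto simp: letters_upto_def)
  then show ?thesis unfolding HEG_tail_def by blast
qed

theorem theoremB:
  fixes G (structure)
    and act :: "'g \<Rightarrow> 's::metric_space \<Rightarrow> 's"
    and \<phi> :: "nat iword set \<Rightarrow> 'g"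
  assumes "group G"
    and "hyperbolic_space TYPE('s)"
    and "isometric_action G act"
    and "cobounded_action G act"
    and "acylindrical_action G act"
    and "\<phi> \<in> hom HEG G"
  shows "\<exists>n\<ge>1. subgroup (\<phi> ` HEG_tail n) G \<and> (\<forall>g\<in>\<phi> ` HEG_tail n. elliptic G act g)"
proof -
  obtain \<delta> where thin: "thin_triangles \<delta> TYPE('s)" and geod: "geodesic_space TYPE('s)"
    using assms(2) by (auto simp: hyperbolic_space_def)
  interpret group G by fact
  interpret acylindrical_space "3 * \<delta> + 2" "TYPE('s)" G act
  proof unfold_locales
    show "min (gprod w x y) (gprod w y z) \<le> gprod w x z + (3 * \<delta> + 2)" for w x y z :: 's
      using thin geod by (rule thin_triangles_four_point)
    show "\<exists>p. dist x p = t \<and> dist p y = dist x y - t" if t: "0 \<le> t" "t \<le> dist x y" for t and x y :: 's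
    proof -
      obtain c where c: "geodesic_from_to c x y"
        using geod unfolding geodesic_space_def geodesic_segment_def by blast
      then have ends: "c 0 = x" "c (dist x y) = y"
        and isom: "\<forall>s\<in>{0..dist x y}. \<forall>t\<in>{0..dist x y}. dist (c s) (c t) = \<bar>s - t\<bar>"
        by (auto simp: geodesic_from_to_def)
      have "dist (c 0) (c t) = t" "dist (c t) (c (dist x y)) = dist x y - t" using isom t by simp_all
      then show ?thesis unfolding ends by blast
    qed
  qed (use assms in auto)
  interpret \<phi>: group_hom HEG G \<phi>
    using group_HEG assms(1,6) by (intro group_hom.intro) (auto simp: group_hom_axioms_def)
  have sub: "subgroup (\<phi> ` HEG_tail n) G" for n
    by (rule \<phi>.subgroup_img_is_subgroup[OF subgroup_HEG_tail])
  show ?thesis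
  proof (rule ccontr)
    assume neg: "\<not> ?thesis"
    define b :: 's where "b = undefined"
    have "\<exists>h. h \<in> HEG_tail n \<and> \<not> elliptic G act (\<phi> h)" for n
      using neg sub[of "Suc n"] HEG_tail_Suc_subset[of n] by (metis (no_types) Suc_eq_plus1 imageE le_add2 subsetD)
    then obtain h where h: "\<And>n. h n \<in> HEG_tail n" "\<And>n. \<not> elliptic G act (\<phi> (h n))" by metis
    have hc: "h n \<in> carrier HEG" for n using h(1)[of n] by (simp add: HEG_tail_def)
    define good where "good g \<longleftrightarrow> growing (100 * (3 * \<delta> + 2) + 1) (act g) b" for g
    have "\<exists>(p::nat) (q::nat) (k::nat). 1 \<le> k \<and> (\<forall>g\<in>carrier G. good (\<phi> (h n) [^] p \<otimes> g [^] k \<otimes> \<phi> (h n) [^] q \<otimes> g [^] k) \<and>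
      (good g \<longrightarrow> dist b (act g b) + 1 \<le> dist b (act (\<phi> (h n) [^] p \<otimes> g [^] k \<otimes> \<phi> (h n) [^] q \<otimes> g [^] k) b)))"
      (is "\<exists>(p::nat) (q::nat) (k::nat). ?P n p q k") for n
    proof -
      have \<eta>: "\<phi> (h n) \<in> carrier G" using hc by simp
      show ?thesis
      proof (rule growing_word[OF \<eta> not_elliptic_unbounded[OF \<eta> h(2)], of b])
        fix k p q :: nat
        assume "1 \<le> k"
          and "\<And>g. g \<in> carrier G \<Longrightarrow>
            growing (100 * (3 * \<delta> + 2) + 1) (act (\<phi> (h n) [^] p \<otimes> g [^] k \<otimes> \<phi> (h n) [^] q \<otimes> g [^] k)) b"
          and "\<And>g. g \<in> carrier G \<Longrightarrow> growing (100 * (3 * \<delta> + 2) + 1) (act g) b \<Longrightarrow>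
            dist b (act g b) + 1 \<le> dist b (act (\<phi> (h n) [^] p \<otimes> g [^] k \<otimes> \<phi> (h n) [^] q \<otimes> g [^] k) b)"
        note this[folded good_def]
        note word = this
        show ?thesis
          by (rule exI[of _ p], rule exI[of _ q], rule exI[of _ k], intro conjI ballI impI)
            (rule word; assumption)+
      qed
    qed
    then obtain p q k :: "nat \<Rightarrow> nat" where pqk: "\<And>n. ?P n (p n) (q n) (k n)" by metis
    have pows: "h n [^]\<^bsub>HEG\<^esub> p n \<in> HEG_tail n" "h n [^]\<^bsub>HEG\<^esub> q n \<in> HEG_tail n" for n
      using \<phi>.G.subgroup_int_pow_closed[OF subgroup_HEG_tail h(1), of _ "int (p n)"]
        \<phi>.G.subgroup_int_pow_closed[OF subgroup_HEG_tail h(1), of _ "int (q n)"] by (simp_all add: int_pow_int)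
    have "1 \<le> k n" for n using pqk by blast
    from HEG_nested_equations[OF pows this] obtain x where
      "\<forall>n. x n \<in> carrier HEG \<and> x n = h n [^]\<^bsub>HEG\<^esub> p n \<otimes>\<^bsub>HEG\<^esub> x (Suc n) [^]\<^bsub>HEG\<^esub> k n
        \<otimes>\<^bsub>HEG\<^esub> h n [^]\<^bsub>HEG\<^esub> q n \<otimes>\<^bsub>HEG\<^esub> x (Suc n) [^]\<^bsub>HEG\<^esub> k n" by (rule exE)
    note x = this[THEN spec, THEN conjunct1] this[THEN spec, THEN conjunct2]
    define g where "g n = \<phi> (x n)" for n
    have gc: "g n \<in> carrier G" for n using x(1) by (simp add: g_def)
    have g: "g n = \<phi> (h n) [^] p n \<otimes> g (Suc n) [^] k n \<otimes> \<phi> (h n) [^] q n \<otimes> g (Suc n) [^] k n" for n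
    proof -
      have "\<phi> (x n) = \<phi> (h n [^]\<^bsub>HEG\<^esub> p n \<otimes>\<^bsub>HEG\<^esub> x (Suc n) [^]\<^bsub>HEG\<^esub> k n \<otimes>\<^bsub>HEG\<^esub> h n [^]\<^bsub>HEG\<^esub> q n \<otimes>\<^bsub>HEG\<^esub> x (Suc n) [^]\<^bsub>HEG\<^esub> k n)"
        by (rule arg_cong[OF x(2)])
      then show ?thesis unfolding g_def using x(1) hc by (simp add: \<phi>.hom_nat_pow)
    qed
    \<comment> \<open>No induction is possible or needed: the word is good for every argument,
      whatever \<open>g (Suc n)\<close> is. Only then may the strict increase be applied to
      \<open>g (Suc n)\<close>.\<close>
    have "good (g n)" for n using pqk[of n] gc[of "Suc n"] g[of n] by metis
    then have step: "dist b (act (g (Suc n)) b) + 1 \<le> dist b (act (g n) b)" for n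
      using pqk[of n] gc[of "Suc n"] g[of n] by metis
    have total: "real n + dist b (act (g n) b) \<le> dist b (act (g 0) b)" for n
    proof (induction n)
      case (Suc n)
      then show ?case using step[of n] by simp
    qed simp
    obtain n :: nat where "dist b (act (g 0) b) < real n" using reals_Archimedean2 by blast
    then show False using total[of n] zero_le_dist[of b "act (g n) b"] by linarith
  qed
qed

end
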